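(* Let $r,k,n$ be positive integers. There is a unique homomorphism of $\mathrm{U}_q(\mathfrak{q}_n)$-supermodules $$\Theta:\mathsf{A}_{k,n}\otimes\mathsf{A}_{r,n}\rightarrow\mathsf{A}_{r,n}\otimes\mathsf{A}_{k,n}$$ such that, with $\mathrm{mul}$ denoting multiplication, $$\Theta\circ(1\otimes\mathrm{mul})=(\mathrm{mul}\otimes1)\circ(1\otimes\Theta)\circ(\Theta\otimes1)\ \text{ on }\ \mathsf{A}_{k,n}\otimes\mathsf{A}_{r,n}\otimes\mathsf{A}_{r,n},$$ $$\Theta\circ(\mathrm{mul}\otimes1)=(1\otimes\mathrm{mul})\circ(\Theta\otimes1)\circ(1\otimes\Theta)\ \text{ on }\ \mathsf{A}_{k,n}\otimes\mathsf{A}_{k,n}\otimes\mathsf{A}_{r,n},$$ and such that $$\Theta(1\otimes x)=x\otimes1\ (x\in\mathsf{A}_{r,n}),\qquad \Theta(y\otimes1)=1\otimes y\ (y\in\mathsf{A}_{k,n}),\qquad \Theta\bigl(T_k^{1[3]}T_r^{2[4]}\bigr)=T_r^{2[3]}T_k^{1[4]}S^{12},$$ where $T_r=\sum_{1\le i\le r,\,a\in I_{n|n}}E_{ia}\otimes t_{ia}$ and $T_k=\sum_{1\le j\le k,\,b\in I_{n|n}}E_{jb}\otimes t_{jb}$ are the generator matrices of $\mathsf{A}_{r,n}$ and $\mathsf{A}_{k,n}$.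
   Context: **Conventions.** The base field is $\mathbb{C}(q)$. Tensor products of superalgebras use the Koszul sign rule $(x\otimes y)(x'\otimes y')=(-1)^{|y||x'|}xx'\otimes yy'$. For $N\ge1$, $I_{N|N}=\{-N,\dots,-1,1,\dots,N\}$, with $|i|=\bar0$ if $i>0$ and $|i|=\bar1$ if $i<0$. Matrix units $E_{ij}$ (possibly rectangular) have parity $|i|+|j|$. $\delta_{a<b}$ is $1$ if $a<b$ and $0$ otherwise; $\xi=q-q^{-1}$; $\varphi(i,j)=(-1)^{|j|}(\delta_{ij}+\delta_{i,-j})$. $V_q$ is the superspace with basis $v_i$, $i\in I_{n|n}$, $|v_i|=|i|$, and $$S=\sum_{i,j\in I_{n|n}}q^{\varphi(i,j)}E_{ii}\otimes E_{jj}+\xi\sum_{i<j}(-1)^{|i|}(E_{ji}+E_{-j,-i})\otimes E_{ij}=\sum_{i,j}S_{ij}\otimes E_{ij}\in\mathrm{End}(V_q)^{\otimes2}.$$ Superscripts indicate tensor positions, and a bracketed position is the one occupied by entries in a superalgebra other than a matrix superalgebra: $T_k^{1[3]}=\sum E_{jb}\otimes1\otimes t_{jb}\otimes1$, $T_r^{2[4]}=\sum1\otimes E_{ia}\otimes1\otimes t_{ia}$, and so on. In the last condition $\Theta$ is applied to tensor positions 3 and 4; in components the condition reads $$\Theta(t_{jb}\otimes t_{ia})=(-1)^{|a||b|}q^{\varphi(b,a)}t_{ia}\otimes t_{jb}+\delta_{b<a}\xi\,t_{ib}\otimes t_{ja}+\delta_{-b<a}(-1)^{|a|}\xi\,t_{i,-b}\otimes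 t_{j,-a}.$$ **$\mathrm{U}_q(\mathfrak{q}_n)$** is the unital associative superalgebra generated by $L_{ij}$ of parity $|i|+|j|$, $i,j\in I_{n|n}$, $i\le j$, with relations $L_{ii}L_{-i,-i}=1=L_{-i,-i}L_{ii}$ and $L^{[1]2}L^{[1]3}S^{23}=S^{23}L^{[1]3}L^{[1]2}$, where $L=\sum_{i\le j}L_{ij}\otimes E_{ij}$ (put $L_{ij}=0$ for $i>j$). It is a Hopf superalgebra with $\Delta(L)=L\otimes L$, i.e. $\Delta(L_{ij})=\sum_k(-1)^{(|i|+|k|)(|k|+|j|)}L_{ik}\otimes L_{kj}$, $\varepsilon(L)=1$, antipode $L\mapsto L^{-1}$; it acts on tensor products through $\Delta$. A $\mathrm{U}_q(\mathfrak{q}_n)$-supermodule superalgebra is a unital associative superalgebra $B$ that is a $\mathrm{U}_q(\mathfrak{q}_n)$-supermodule with $u.(ab)=\sum_{(u)}(-1)^{|u_{(2)}||a|}(u_{(1)}.a)(u_{(2)}.b)$ and $u.1=\varepsilon(u)1$. **Quantum coordinate superalgebra $\mathsf{A}_{r,n}$.** Unital associative superalgebra generated by $t_{ia}$ of parity $|i|+|a|$, $i\in I_{r|r}$, $a\in I_{n|n}$, with relations $t_{ia}=t_{-i,-a}$ and $S^{12}T^{1[3]}T^{2[3]}=T^{2[3]}T^{1[3]}S^{12}$, where $T=\sum E_{ia}\otimes t_{ia}$ (the left $S$ is the matrix of the same form with indices in $I_{r|r}$). It is equivalently presented by generators $t_{ia}$, $1\le i\le r$, $a\in I_{n|n}$,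 with relations $$q^{\delta_{ij}}t_{ia}t_{jb}-(-1)^{|a||b|}q^{\varphi(a,b)}t_{jb}t_{ia}=\xi(\delta_{a<b}-\delta_{j<i})t_{ja}t_{ib}+(-1)^{|b|}\xi\,\delta_{-a<b}\,t_{j,-a}t_{i,-b}.$$ It is a $\mathrm{U}_q(\mathfrak{q}_n)$-supermodule superalgebra with action $\Phi$ determined by $L^{[2]3}\cdot_\Phi T^{1[2]}=T^{1[2]}S^{13}$, where $L^{[2]3}\cdot_\Phi T^{1[2]}:=\sum(-1)^{(|a|+|b|)(|i|+|c|)}E_{ic}\otimes\Phi_{L_{ab}}(t_{ic})\otimes E_{ab}$. *)

theory Defs
  imports
    "HOL-Computational_Algebra.Polynomial"
    "HOL-Computational_Algebra.Fraction_Field"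
    "HOL-Library.Poly_Mapping"
    "HOL-Library.Z2"
    "HOL-Library.Cardinality"
    Complex_Main
begin

section \<open>The base field\<close>

type_synonym cq = "complex poly fract"

definition qq :: cq
  where "qq = Fract [:0, 1:] 1"

definition xi :: cq
  where "xi = qq - inverse qq"

(* (-1)^p *)
definition koszul :: "bit \<Rightarrow> cq"
  where "koszul p = (if p = 0 then 1 else -1)"

lemma koszul_simps [simp]: "koszul 0 = 1" "koszul 1 = -1"
  by (auto simp: koszul_def)

lemma koszul_add: "koszul (p + s) = koszul p * koszul s"
  by (cases p; cases s) auto

lemma qq_neq_0: "qq \<noteq> 0"
  by (simp add: qq_def Zero_fract_def eq_fract)

section \<open>Superspaces and superalgebras\<close>

class qspace = ab_group_add +
  fixes scaleq :: "cq \<Rightarrow> 'a \<Rightarrow> 'a"  (infixr "*\<^sub>q" 75)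
  assumes scaleq_add_right: "c *\<^sub>q (x + y) = c *\<^sub>q x + c *\<^sub>q y"
    and scaleq_add_left: "(c + d) *\<^sub>q x = c *\<^sub>q x + d *\<^sub>q x"
    and scaleq_scaleq: "c *\<^sub>q (d *\<^sub>q x) = (c * d) *\<^sub>q x"
    and scaleq_one: "1 *\<^sub>q x = x"

global_interpretation qspace: vector_space "scaleq :: cq \<Rightarrow> 'a \<Rightarrow> 'a :: qspace"
  by standard (simp_all add: scaleq_add_right scaleq_add_left scaleq_scaleq scaleq_one)

abbreviation qlinear :: "('a::qspace \<Rightarrow> 'b::qspace) \<Rightarrow> bool"
  where "qlinear \<equiv> Vector_Spaces.linear scaleq scaleq"

definition qbilinear :: "('a::qspace \<Rightarrow> 'b::qspace \<Rightarrow> 'c::qspace) \<Rightarrow> bool"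
  where "qbilinear f \<longleftrightarrow> (\<forall>b. qlinear (\<lambda>a. f a b)) \<and> (\<forall>a. qlinear (f a))"

(* A Z/2-grading is given by the projections hpart p onto the homogeneous components;
   x is homogeneous of parity p iff hpart p x = x. *)
class superspace = qspace +
  fixes hpart :: "bit \<Rightarrow> 'a \<Rightarrow> 'a"
  assumes hpart_add: "hpart p (x + y) = hpart p x + hpart p y"
    and hpart_scaleq: "hpart p (c *\<^sub>q x) = c *\<^sub>q hpart p x"
    and hpart_hpart: "hpart p (hpart s x) = (if p = s then hpart p x else 0)"
    and hpart_sum: "hpart 0 x + hpart 1 x = x"

class superalgebra = superspace + ring + monoid_mult +
  assumes scaleq_mult_left: "(c *\<^sub>q x) * y = c *\<^sub>q (x * y)"
    and scaleq_mult_right: "x * (c *\<^sub>q y) = c *\<^sub>q (x * y)"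
    and hpart_one: "hpart 0 1 = 1"
    and hpart_mult: "hpart p x = x \<Longrightarrow> hpart s y = y \<Longrightarrow> hpart (p + s) (x * y) = x * y"

lemma qlinear_iff:
  "qlinear f \<longleftrightarrow> (\<forall>x y. f (x + y) = f x + f y) \<and> (\<forall>c x. f (c *\<^sub>q x) = c *\<^sub>q f x)"
  by (simp add: Vector_Spaces.linear_iff qspace.vector_space_axioms)

lemma qlinearI:
  "(\<And>x y. f (x + y) = f x + f y) \<Longrightarrow> (\<And>c x. f (c *\<^sub>q x) = c *\<^sub>q f x) \<Longrightarrow> qlinear f"
  by (simp add: qlinear_iff)

lemma qlinear_add: "qlinear f \<Longrightarrow> f (x + y) = f x + f y"
  and qlinear_scale: "qlinear f \<Longrightarrow> f (c *\<^sub>q x) = c *\<^sub>q f x"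
  by (auto simp: qlinear_iff)

lemma qlinear_0: "qlinear f \<Longrightarrow> f 0 = 0"
  using qlinear_add[of f 0 0] by simp

lemma qlinear_diff: "qlinear f \<Longrightarrow> f (x - y) = f x - f y"
  using qlinear_add[of f "x - y" y] by simp

lemma qlinear_sum: "qlinear f \<Longrightarrow> f (sum g A) = (\<Sum>x\<in>A. f (g x))"
  by (induction A rule: infinite_finite_induct) (auto simp: qlinear_0 qlinear_add)

lemma qbilinearI:
  assumes "\<And>a a' b. f (a + a') b = f a b + f a' b" "\<And>c a b. f (c *\<^sub>q a) b = c *\<^sub>q f a b"
    and "\<And>a b b'. f a (b + b') = f a b + f a b'" "\<And>c a b. f a (c *\<^sub>q b) = c *\<^sub>q f a b"
  shows "qbilinear f"
  using assms by (simp add: qbilinear_def qlinear_iff)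

lemma qbilinearD:
  assumes "qbilinear f"
  shows "f (a + a') b = f a b + f a' b" "f (c *\<^sub>q a) b = c *\<^sub>q f a b"
    and "f a (b + b') = f a b + f a b'" "f a (c *\<^sub>q b) = c *\<^sub>q f a b"
  using assms by (simp_all add: qbilinear_def qlinear_iff)


section \<open>Free vector spaces and tensor products\<close>

definition fscale :: "cq \<Rightarrow> ('x \<Rightarrow>\<^sub>0 cq) \<Rightarrow> ('x \<Rightarrow>\<^sub>0 cq)"
  where "fscale c = Poly_Mapping.map ((*) c)"

lemma lookup_fscale [simp]: "Poly_Mapping.lookup (fscale c p) x = c * Poly_Mapping.lookup p x"
  by (cases "c = 0") (auto simp: fscale_def map.rep_eq when_def)

global_interpretation fspace: vector_space "fscale :: cq \<Rightarrow> ('x \<Rightarrow>\<^sub>0 cq) \<Rightarrow> ('x \<Rightarrow>\<^sub>0 cq)"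
  by standard (auto intro!: poly_mapping_eqI simp: lookup_add algebra_simps)

definition bilinear_rels :: "('a::qspace \<times> 'b::qspace \<Rightarrow>\<^sub>0 cq) set"
  where "bilinear_rels =
    {Poly_Mapping.single (a + a', b) 1 - Poly_Mapping.single (a, b) 1 - Poly_Mapping.single (a', b) 1 | a a' b. True}
    \<union> {Poly_Mapping.single (a, b + b') 1 - Poly_Mapping.single (a, b) 1 - Poly_Mapping.single (a, b') 1 | a b b'. True}
    \<union> {Poly_Mapping.single (c *\<^sub>q a, b) 1 - Poly_Mapping.single (a, b) c | c a b. True}
    \<union> {Poly_Mapping.single (a, c *\<^sub>q b) 1 - Poly_Mapping.single (a, b) c | c a b. True}"

lemma span_equivp: "equivp (\<lambda>x y. x - y \<in> fspace.span R)"
proof (rule equivpI)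
  show "reflp (\<lambda>x y. x - y \<in> fspace.span R)" by (simp add: reflp_def fspace.span_zero)
  show "symp (\<lambda>x y. x - y \<in> fspace.span R)"
    by (metis (no_types, lifting) fspace.span_neg minus_diff_eq sympI)
  show "transp (\<lambda>x y. x - y \<in> fspace.span R)"
    by (rule transpI) (metis (no_types, lifting) add_diff_eq diff_add_cancel fspace.span_add)
qed

quotient_type (overloaded) ('a, 'b) tensor  (infixr "\<otimes>" 73) =
  "('a::qspace \<times> 'b::qspace) \<Rightarrow>\<^sub>0 cq" / "\<lambda>x y. x - y \<in> fspace.span bilinear_rels"
  by (rule span_equivp)

instantiation tensor :: (qspace, qspace) qspace
begin

lift_definition zero_tensor :: "'a \<otimes> 'b" is 0 .

lift_definition plus_tensor :: "'a \<otimes> 'b \<Rightarrow> 'a \<otimes> 'b \<Rightarrow> 'a \<otimes> 'b" is "(+)"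
  unfolding add_diff_add by (rule fspace.span_add)

lift_definition uminus_tensor :: "'a \<otimes> 'b \<Rightarrow> 'a \<otimes> 'b" is uminus
  unfolding minus_diff_minus by (rule fspace.span_neg)

lift_definition minus_tensor :: "'a \<otimes> 'b \<Rightarrow> 'a \<otimes> 'b \<Rightarrow> 'a \<otimes> 'b" is "(-)"
proof -
  fix a b c d :: "('a \<times> 'b) \<Rightarrow>\<^sub>0 cq" and R
  assume "a - b \<in> fspace.span R" "c - d \<in> fspace.span R"
  then have "(a - b) - (c - d) \<in> fspace.span R" by (rule fspace.span_diff)
  moreover have "(a - b) - (c - d) = (a - c) - (b - d)" by (simp add: algebra_simps)
  ultimately show "(a - c) - (b - d) \<in> fspace.span R" by simp
qed

lift_definition scaleq_tensor :: "cq \<Rightarrow> 'a \<otimes> 'b \<Rightarrow> 'a \<otimes> 'b" is fscale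
  unfolding fspace.scale_right_diff_distrib[symmetric] by (rule fspace.span_scale)

instance
proof
  have eq: "x - y \<in> fspace.span R" if "x = y" for x y :: "'x \<Rightarrow>\<^sub>0 cq" and R
    using that by (simp add: fspace.span_zero)
  fix a b c :: "'a \<otimes> 'b" and k l :: cq
  show "a + b + c = a + (b + c)" by (transfer, rule eq, rule add.assoc)
  show "a + b = b + a" by (transfer, rule eq, rule add.commute)
  show "0 + a = a" by (transfer, rule eq, rule add_0)
  show "- a + a = 0" by (transfer, rule eq, rule left_minus)
  show "a - b = a + - b" by (transfer, rule eq, rule diff_conv_add_uminus)
  show "k *\<^sub>q (a + b) = k *\<^sub>q a + k *\<^sub>q b"
    by (transfer, rule eq, rule fspace.scale_right_distrib)
  show "(k + l) *\<^sub>q a = k *\<^sub>q a + l *\<^sub>q a"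
    by (transfer, rule eq, rule fspace.scale_left_distrib)
  show "k *\<^sub>q l *\<^sub>q a = (k * l) *\<^sub>q a" by (transfer, rule eq, rule fspace.scale_scale)
  show "1 *\<^sub>q a = a" by (transfer, rule eq, rule fspace.scale_one)
qed

end

lift_definition tens :: "'a::qspace \<Rightarrow> 'b::qspace \<Rightarrow> 'a \<otimes> 'b"  (infixr "\<otimes>" 73)
  is "\<lambda>a b. Poly_Mapping.single (a, b) 1" .

lemma fscale_single [simp]: "fscale c (Poly_Mapping.single x d) = Poly_Mapping.single x (c * d)"
  by (rule poly_mapping_eqI) (auto simp: lookup_single when_def)

lemma tens_bilinear: "qbilinear (\<otimes>)"
proof (rule qbilinearI; transfer)
  fix a a' :: 'a and b b' :: 'b and c
  show "Poly_Mapping.single (a + a', b) 1 - (Poly_Mapping.single (a, b) 1 + Poly_Mapping.single (a', b) 1)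
      \<in> fspace.span bilinear_rels"
    by (rule fspace.span_base) (unfold bilinear_rels_def diff_diff_eq[symmetric], blast)
  show "Poly_Mapping.single (a, b + b') 1 - (Poly_Mapping.single (a, b) 1 + Poly_Mapping.single (a, b') 1)
      \<in> fspace.span bilinear_rels"
    by (rule fspace.span_base) (unfold bilinear_rels_def diff_diff_eq[symmetric], blast)
  show "Poly_Mapping.single (c *\<^sub>q a, b) 1 - fscale c (Poly_Mapping.single (a, b) 1) \<in> fspace.span bilinear_rels"
    by (rule fspace.span_base) (unfold bilinear_rels_def fscale_single mult_1_right, blast)
  show "Poly_Mapping.single (a, c *\<^sub>q b) 1 - fscale c (Poly_Mapping.single (a, b) 1) \<in> fspace.span bilinear_rels"
    by (rule fspace.span_base) (unfold bilinear_rels_def fscale_single mult_1_right, blast)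
qed

lemmas tens_simps = qbilinearD[OF tens_bilinear]

lemma tens_0 [simp]: "0 \<otimes> b = 0" "a \<otimes> 0 = 0"
  using tens_simps(1)[of 0 0 b] tens_simps(3)[of a 0 0] by simp_all

lemma free_induct [case_names single add]:
  fixes p :: "'x \<Rightarrow>\<^sub>0 cq"
  assumes single: "\<And>x c. P (Poly_Mapping.single x c)" and add: "\<And>p r. P p \<Longrightarrow> P r \<Longrightarrow> P (p + r)"
  shows "P p"
proof (induction "Poly_Mapping.keys p" arbitrary: p rule: infinite_finite_induct)
  case empty
  then have "p = 0" by (metis keys_eq_empty)
  then show ?case using single[of _ 0] by simp
next
  case (insert k A)
  let ?c = "Poly_Mapping.lookup p k"
  let ?r = "p - Poly_Mapping.single k ?c"
  have "Poly_Mapping.keys ?r = A"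
    using insert(2) insert(4)[symmetric]
    by (auto simp: in_keys_iff lookup_minus lookup_single when_def set_eq_iff split: if_splits)
  then have "P ?r" by (intro insert(3)) simp
  then have "P (?r + Poly_Mapping.single k ?c)" by (rule add[OF _ single])
  then show ?case by simp
qed simp

definition fext :: "('x \<Rightarrow> 'c::qspace) \<Rightarrow> ('x \<Rightarrow>\<^sub>0 cq) \<Rightarrow> 'c"
  where "fext f p = (\<Sum>x\<in>Poly_Mapping.keys p. Poly_Mapping.lookup p x *\<^sub>q f x)"

lemma fext_superset:
  assumes "finite A" "Poly_Mapping.keys p \<subseteq> A"
  shows "fext f p = (\<Sum>x\<in>A. Poly_Mapping.lookup p x *\<^sub>q f x)"
  unfolding fext_def using assms
  by (intro sum.mono_neutral_left) (auto simp: in_keys_iff)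

lemma fext_add: "fext f (p + r) = fext f p + fext f r"
proof -
  let ?A = "Poly_Mapping.keys p \<union> Poly_Mapping.keys r"
  have "Poly_Mapping.keys (p + r) \<subseteq> ?A" by (rule Poly_Mapping.keys_add)
  then show ?thesis
    using fext_superset[of ?A "p + r" f] fext_superset[of ?A p f] fext_superset[of ?A r f]
    by (simp add: lookup_add scaleq_add_left sum.distrib)
qed

lemma fext_scale: "fext f (fscale c p) = c *\<^sub>q fext f p"
proof -
  have "Poly_Mapping.keys (fscale c p) \<subseteq> Poly_Mapping.keys p" by (auto simp: in_keys_iff)
  then show ?thesis
    by (simp add: fext_superset[of "Poly_Mapping.keys p"] qspace.scale_sum_right scaleq_scaleq)
qed

lemma fext_linear: "Vector_Spaces.linear fscale scaleq (fext f)"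
  by (simp add: Vector_Spaces.linear_iff qspace.vector_space_axioms fspace.vector_space_axioms
      fext_add fext_scale)

lemma fext_single [simp]: "fext f (Poly_Mapping.single x c) = c *\<^sub>q f x"
  by (cases "c = 0") (auto simp: fext_def)

lemma fext_diff: "fext f (p - r) = fext f p - fext f r"
  using fext_add[of f "p - r" r] by simp

lemma fext_span_0:
  assumes "\<And>x. x \<in> R \<Longrightarrow> fext f x = 0" "p \<in> fspace.span R"
  shows "fext f p = 0"
  using assms(2)
  by (induction rule: fspace.span_induct_alt)
    (auto simp: assms(1) fext_add fext_scale, simp add: fext_def)

(* The linear map induced by f; it is meaningful for bilinear f only. *)
definition tlift :: "('a::qspace \<Rightarrow> 'b::qspace \<Rightarrow> 'c::qspace) \<Rightarrow> 'a \<otimes> 'b \<Rightarrow> 'c"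
  where "tlift f t = fext (\<lambda>(a, b). f a b) (rep_tensor t)"

lemma tlift_abs:
  assumes "qbilinear f"
  shows "tlift f (abs_tensor p) = fext (\<lambda>(a, b). f a b) p"
proof -
  have "rep_tensor (abs_tensor p) - p \<in> fspace.span (bilinear_rels :: ('a \<times> 'b \<Rightarrow>\<^sub>0 cq) set)"
    using rep_abs_rsp_left[OF Quotient3_tensor, of p p] by (simp add: fspace.span_zero)
  then have "fext (\<lambda>(a, b). f a b) (rep_tensor (abs_tensor p) - p) = 0"
    by (rule fext_span_0[rotated])
      (auto simp: bilinear_rels_def fext_diff scaleq_one qbilinearD[OF assms])
  then show ?thesis by (simp add: tlift_def fext_diff)
qed

lemma tlift_tens [simp]: "qbilinear f \<Longrightarrow> tlift f (a \<otimes> b) = f a b"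
  by (simp add: tens.abs_eq tlift_abs scaleq_one)

lemma tlift_linear: assumes "qbilinear f" shows "qlinear (tlift f)"
proof (rule qlinearI)
  show "tlift f (x + y) = tlift f x + tlift f y" for x y
    by (induction x rule: tensor.abs_induct; induction y rule: tensor.abs_induct) (simp add: plus_tensor.abs_eq tlift_abs[OF assms] fext_add)
  show "tlift f (c *\<^sub>q x) = c *\<^sub>q tlift f x" for c x
    by (induction x rule: tensor.abs_induct) (simp add: scaleq_tensor.abs_eq tlift_abs[OF assms] fext_scale)
qed

lemma tensor_induct [case_names tens add, induct type: tensor]:
  assumes tens: "\<And>a b. P (a \<otimes> b)" and add: "\<And>x y. P x \<Longrightarrow> P y \<Longrightarrow> P (x + y)"
  shows "P x"
proof -
  have "P (abs_tensor p)" for p :: "('a \<times> 'b) \<Rightarrow>\<^sub>0 cq"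
  proof (induction p rule: free_induct)
    case (single x c)
    obtain a b where x: "x = (a, b)" by (cases x)
    have "abs_tensor (Poly_Mapping.single x c) = (c *\<^sub>q a) \<otimes> b"
      unfolding tens_simps by (simp add: tens.abs_eq scaleq_tensor.abs_eq x)
    then show ?case by (simp add: tens)
  next
    case (add p r)
    then show ?case using assms(2) by (simp flip: plus_tensor.abs_eq)
  qed
  then show ?thesis by (induction x rule: tensor.abs_induct)
qed

lemma qlinear_tensor_eqI:
  assumes "qlinear f" "qlinear g" "\<And>a b. f (a \<otimes> b) = g (a \<otimes> b)"
  shows "f x = g x"
  by (induction x) (simp_all add: assms qlinear_add[OF assms(1)] qlinear_add[OF assms(2)])

lemma hpart_linear: "qlinear (hpart p)"
  by (rule qlinearI) (simp_all add: hpart_add hpart_scaleq)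

lemmas hpart_0 [simp] = qlinear_0[OF hpart_linear]

lemma hpart_minus [simp]: "hpart p (- x) = - hpart p x"
  using qlinear_diff[OF hpart_linear, of p 0 x] by simp

lemma hpart_hom: "hpart p x = x \<Longrightarrow> hpart s x = (if s = p then x else 0)"
  by (metis hpart_hpart)

lemma tensor_induct_hom [case_names tens add]:
  fixes x :: "'a::superspace \<otimes> 'b::superspace"
  assumes tens: "\<And>a b p s. hpart p a = a \<Longrightarrow> hpart s b = b \<Longrightarrow> P (a \<otimes> b)"
    and add: "\<And>x y. P x \<Longrightarrow> P y \<Longrightarrow> P (x + y)"
  shows "P x"
proof (induction x)
  case (tens a b)
  have "P (hpart p a \<otimes> hpart s b)" for p s
    by (rule assms(1)[of p _ s]) (simp_all add: hpart_hpart)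
  then have "P ((hpart 0 a \<otimes> hpart 0 b + hpart 0 a \<otimes> hpart 1 b)
      + (hpart 1 a \<otimes> hpart 0 b + hpart 1 a \<otimes> hpart 1 b))"
    by (intro add)
  moreover have "a \<otimes> b = (hpart 0 a \<otimes> hpart 0 b + hpart 0 a \<otimes> hpart 1 b)
      + (hpart 1 a \<otimes> hpart 0 b + hpart 1 a \<otimes> hpart 1 b)"
    by (metis hpart_sum tens_simps(1,3))
  ultimately show ?case by simp
qed (rule add)

instantiation tensor :: (superspace, superspace) superspace
begin

definition hpart_tensor :: "bit \<Rightarrow> 'a \<otimes> 'b \<Rightarrow> 'a \<otimes> 'b"
  where "hpart_tensor p = tlift (\<lambda>a b. \<Sum>s\<in>{0, 1}. hpart s a \<otimes> hpart (p + s) b)"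

lemma hpart_tensor_bilinear:
  "qbilinear (\<lambda>(a::'a) (b::'b). \<Sum>s\<in>{0, 1}. hpart s a \<otimes> hpart (p + s) b)"
  by (rule qbilinearI) (simp_all add: hpart_add hpart_scaleq tens_simps scaleq_add_right)

lemma hpart_tens: "hpart p ((a::'a) \<otimes> (b::'b)) = (\<Sum>s\<in>{0, 1}. hpart s a \<otimes> hpart (p + s) b)"
  by (simp only: hpart_tensor_def tlift_tens[OF hpart_tensor_bilinear])

lemma hpart_tens_hom:
  assumes "hpart r (a::'a) = a" "hpart s (b::'b) = b"
  shows "hpart p (a \<otimes> b) = (if p = r + s then a \<otimes> b else 0)"
  by (cases p; cases r; cases s)
    (simp_all add: hpart_tens hpart_hom[OF assms(1)] hpart_hom[OF assms(2)])

instance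
proof
  fix p s :: bit and x y :: "'a \<otimes> 'b" and c
  show hadd: "hpart p (x + y) = hpart p x + hpart p y" for x y :: "'a \<otimes> 'b" and p
    unfolding hpart_tensor_def by (rule qlinear_add[OF tlift_linear[OF hpart_tensor_bilinear]])
  show "hpart p (c *\<^sub>q x) = c *\<^sub>q hpart p x"
    unfolding hpart_tensor_def by (rule qlinear_scale[OF tlift_linear[OF hpart_tensor_bilinear]])
  have zero: "hpart p 0 = (0::'a \<otimes> 'b)" for p using hadd[of p 0 0] by simp
  show "hpart p (hpart s x) = (if p = s then hpart p x else 0)"
  proof (induction x rule: tensor_induct_hom)
    case (tens a b r t)
    show ?case by (simp add: hpart_tens_hom[OF tens] zero)
  qed (simp add: hadd)
  show "hpart 0 x + hpart 1 x = x"
  proof (induction x rule: tensor_induct_hom)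
    case (tens a b r t)
    show ?case by (cases r; cases t) (simp_all add: hpart_tens_hom[OF tens])
  next
    case (add x y)
    have "hpart 0 (x + y) + hpart 1 (x + y) = (hpart 0 x + hpart 1 x) + (hpart 0 y + hpart 1 y)"
      by (simp add: hadd)
    then show ?case using add by simp
  qed
qed

end

(* The Koszul sign rule (a \<otimes> b)(a' \<otimes> b') = (-1)^(|b||a'|) aa' \<otimes> bb', summed over the
   homogeneous components of b and a'. *)
definition tmult :: "'a::superalgebra \<Rightarrow> 'b::superalgebra \<Rightarrow> 'a \<Rightarrow> 'b \<Rightarrow> 'a \<otimes> 'b"
  where "tmult a b a' b' =
    (\<Sum>s\<in>{0, 1}. \<Sum>t\<in>{0, 1}. koszul (s * t) *\<^sub>q ((a * hpart t a') \<otimes> (hpart s b * b')))"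

lemmas salg_simps = hpart_add hpart_scaleq tens_simps scaleq_add_right distrib_left distrib_right
  scaleq_mult_left scaleq_mult_right

lemma scaleq_left_commute: "c *\<^sub>q (d *\<^sub>q x) = d *\<^sub>q (c *\<^sub>q x)"
  by (simp add: scaleq_scaleq mult.commute)

lemma qbilinear_sum:
  assumes "\<And>i. i \<in> I \<Longrightarrow> qbilinear (f i)"
  shows "qbilinear (\<lambda>a b. \<Sum>i\<in>I. f i a b)"
  using assms unfolding qbilinear_def qlinear_iff
  by (simp add: sum.distrib qspace.scale_sum_right)

lemma qbilinear_scale: "qbilinear f \<Longrightarrow> qbilinear (\<lambda>a b. c *\<^sub>q f a b)"
proof -
  assume f: "qbilinear f"
  show "qbilinear (\<lambda>a b. c *\<^sub>q f a b)"
    by (rule qbilinearI) (simp_all only: qbilinearD[OF f] scaleq_add_right scaleq_left_commute[of c])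
qed

lemma tmult_bilinear: "qbilinear (tmult a b)" "qbilinear (\<lambda>a b. tmult a b a' b')"
  unfolding tmult_def
  by (intro qbilinear_sum qbilinear_scale qbilinearI; simp add: salg_simps)+

lemma tmult_bilinear2: "qbilinear (\<lambda>a b. tlift (tmult a b) y)"
proof (induction y)
  case (tens a b)
  then show ?case by (simp add: tmult_bilinear)
next
  case (add x y)
  then show ?case
    by (simp add: qlinear_add[OF tlift_linear[OF tmult_bilinear(1)]] qbilinear_def qlinear_iff
        scaleq_add_right)
qed

instantiation tensor :: (superalgebra, superalgebra) superalgebra
begin

definition one_tensor :: "'a \<otimes> 'b" where "one_tensor = 1 \<otimes> 1"

definition times_tensor :: "'a \<otimes> 'b \<Rightarrow> 'a \<otimes> 'b \<Rightarrow> 'a \<otimes> 'b"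
  where "x * y = tlift (\<lambda>a b. tlift (tmult a b) y) x"

lemma times_tens: "(a \<otimes> b) * (a' \<otimes> b') = tmult a b a' (b'::'b)" for a :: 'a
  by (simp add: times_tensor_def tmult_bilinear tmult_bilinear2)

lemma times_tens_hom:
  assumes "hpart s (b::'b) = b" "hpart t (a'::'a) = a'"
  shows "(a \<otimes> b) * (a' \<otimes> b') = koszul (s * t) *\<^sub>q ((a * a') \<otimes> (b * b'))"
  by (cases s; cases t)
    (simp_all add: times_tens tmult_def hpart_hom[OF assms(1)] hpart_hom[OF assms(2)] scaleq_one)

instance
proof
  fix p s :: bit and x y z :: "'a \<otimes> 'b" and c
  have times_linear: "qlinear (\<lambda>y::'a \<otimes> 'b. x * y)" "qlinear (\<lambda>x. x * y)" for x y :: "'a \<otimes> 'b"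
  proof -
    show "qlinear (\<lambda>x. x * y)"
      unfolding times_tensor_def by (rule tlift_linear[OF tmult_bilinear2])
    show "qlinear (\<lambda>y. x * y)"
    proof (induction x)
      case (tens a b)
      then show ?case
        by (simp add: times_tensor_def tmult_bilinear2 tlift_linear[OF tmult_bilinear(1)])
    next
      case (add x y)
      have "(x + y) * z = x * z + y * z" for z
        unfolding times_tensor_def by (rule qlinear_add[OF tlift_linear[OF tmult_bilinear2]])
      then show ?case using add by (simp add: qlinear_iff scaleq_add_right algebra_simps)
    qed
  qed
  note tl = qlinear_add[OF times_linear(1)] qlinear_add[OF times_linear(2)]
    qlinear_scale[OF times_linear(1)] qlinear_scale[OF times_linear(2)]
    qlinear_0[OF times_linear(1)] qlinear_0[OF times_linear(2)]
  show "(x + y) * z = x * z + y * z" "x * (y + z) = x * y + x * z"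
    "(c *\<^sub>q x) * y = c *\<^sub>q (x * y)" "x * (c *\<^sub>q y) = c *\<^sub>q (x * y)"
    by (rule tl)+
  show "x * y * z = x * (y * z)"
  proof (induction x rule: tensor_induct_hom)
    case (tens a1 b1 p1 s1)
    then show ?case
    proof (induction y rule: tensor_induct_hom)
      case (tens a2 b2 p2 s2)
      then show ?case
      proof (induction z rule: tensor_induct_hom)
        case (tens a3 b3 p3 s3)
        have b: "hpart (s1 + s2) (b1 * b2) = b1 * b2" and a: "hpart (p2 + p3) (a2 * a3) = a2 * a3"
          using tens by (blast intro: hpart_mult)+
        have eqs: "(a1 \<otimes> b1) * (a2 \<otimes> b2) = koszul (s1 * p2) *\<^sub>q ((a1 * a2) \<otimes> (b1 * b2))"
          "(a2 \<otimes> b2) * (a3 \<otimes> b3) = koszul (s2 * p3) *\<^sub>q ((a2 * a3) \<otimes> (b2 * b3))"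
          "((a1 * a2) \<otimes> (b1 * b2)) * (a3 \<otimes> b3)
            = koszul ((s1 + s2) * p3) *\<^sub>q ((a1 * a2 * a3) \<otimes> (b1 * b2 * b3))"
          "(a1 \<otimes> b1) * ((a2 * a3) \<otimes> (b2 * b3))
            = koszul (s1 * (p2 + p3)) *\<^sub>q ((a1 * (a2 * a3)) \<otimes> (b1 * (b2 * b3)))"
          using tens a b by (blast intro: times_tens_hom)+
        have sign: "koszul (s1 * p2) * koszul ((s1 + s2) * p3)
            = koszul (s2 * p3) * koszul (s1 * (p2 + p3))"
          by (cases s1; cases s2; cases p2; cases p3) simp_all
        show ?case by (simp only: eqs tl scaleq_scaleq sign mult.assoc)
      qed (simp add: tl)
    qed (simp add: tl)
  qed (simp add: tl)
  have one: "hpart 0 (1::'a) = 1" "hpart 0 (1::'b) = 1" by (rule hpart_one)+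
  show "1 * x = x"
    by (induction x rule: tensor_induct_hom)
      (simp_all add: tl, simp add: one_tensor_def times_tens_hom[OF one(2)] scaleq_one)
  show "x * 1 = x"
    by (induction x rule: tensor_induct_hom)
      (simp_all add: tl, simp add: one_tensor_def times_tens_hom[OF _ one(1)] scaleq_one)
  show "hpart 0 (1::'a \<otimes> 'b) = 1"
    by (simp add: one_tensor_def hpart_tens_hom[OF one])
  have part: "hpart r (x * y) = hpart 0 x * hpart r y + hpart 1 x * hpart (r + 1) y" for r
  proof (induction x rule: tensor_induct_hom)
    case (tens a1 b1 p1 s1)
    then show ?case
    proof (induction y rule: tensor_induct_hom)
      case (tens a2 b2 p2 s2)
      have b: "hpart (s1 + s2) (b1 * b2) = b1 * b2" and a: "hpart (p1 + p2) (a1 * a2) = a1 * a2"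
        using tens by (blast intro: hpart_mult)+
      have eq: "(a1 \<otimes> b1) * (a2 \<otimes> b2) = koszul (s1 * p2) *\<^sub>q ((a1 * a2) \<otimes> (b1 * b2))"
        using tens by (blast intro: times_tens_hom)
      have parts: "hpart r ((a1 * a2) \<otimes> (b1 * b2))
          = (if r = p1 + p2 + (s1 + s2) then (a1 * a2) \<otimes> (b1 * b2) else 0)"
        "hpart r (a1 \<otimes> b1) = (if r = p1 + s1 then a1 \<otimes> b1 else 0)"
        "hpart r (a2 \<otimes> b2) = (if r = p2 + s2 then a2 \<otimes> b2 else 0)" for r
        using tens by (simp_all only: hpart_tens_hom[OF a b] hpart_tens_hom)
      show ?case
        by (cases r; cases p1; cases p2; cases s1; cases s2)
          (simp_all add: eq parts hpart_scaleq tl)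
    qed (simp add: tl hpart_add)
  qed (simp add: tl hpart_add)
  show "hpart (p + s) (x * y) = x * y" if "hpart p x = x" "hpart s y = y"
    unfolding part by (cases p; cases s) (simp_all add: hpart_hom[OF that(1)] hpart_hom[OF that(2)] tl)
qed

end


section \<open>Superalgebras given by generators and relations\<close>

(* Words form the free monoid, written additively so that the monoid algebra
   of Poly_Mapping is the free associative unital algebra. *)
datatype 'g fword = Word (letters: "'g list")

instantiation fword :: (type) monoid_add
begin

definition zero_fword :: "'g fword" where "zero_fword = Word []"

definition plus_fword :: "'g fword \<Rightarrow> 'g fword \<Rightarrow> 'g fword"
  where "plus_fword v w = Word (letters v @ letters w)"

instance by standard (simp_all add: zero_fword_def plus_fword_def)

end

type_synonym 'g falg = "'g fword \<Rightarrow>\<^sub>0 cq"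

definition fgen :: "'g \<Rightarrow> 'g falg"
  where "fgen g = Poly_Mapping.single (Word [g]) 1"

definition word_par :: "('g \<Rightarrow> bit) \<Rightarrow> 'g fword \<Rightarrow> bit"
  where "word_par d w = sum_list (map d (letters w))"

lemma word_par_simps [simp]:
  "word_par d 0 = 0" "word_par d (v + w) = word_par d v + word_par d w" "word_par d (Word [g]) = d g"
  by (simp_all add: word_par_def zero_fword_def plus_fword_def)

definition fhom :: "('g \<Rightarrow> bit) \<Rightarrow> bit \<Rightarrow> 'g falg \<Rightarrow> bool"
  where "fhom d p f \<longleftrightarrow> (\<forall>w\<in>Poly_Mapping.keys f. word_par d w = p)"

lemma fhom_add: "fhom d p f \<Longrightarrow> fhom d p g \<Longrightarrow> fhom d p (f + g)"
  using Poly_Mapping.keys_add[of f g] by (auto simp: fhom_def)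

lemma fhom_scale: "fhom d p f \<Longrightarrow> fhom d p (fscale c f)"
  by (auto simp: fhom_def in_keys_iff)

lemma fhom_0 [simp]: "fhom d p 0"
  by (simp add: fhom_def)

lemma fhom_diff: "fhom d p f \<Longrightarrow> fhom d p g \<Longrightarrow> fhom d p (f - g)"
  using fhom_add[of d p f "fscale (-1) g"] fhom_scale[of d p g "-1"] by simp

lemma fhom_sum: "(\<And>i. i \<in> I \<Longrightarrow> fhom d p (f i)) \<Longrightarrow> fhom d p (sum f I)"
  by (induction I rule: infinite_finite_induct) (auto intro: fhom_add)

lemma fhom_mult: "fhom d p f \<Longrightarrow> fhom d s g \<Longrightarrow> fhom d (p + s) (f * g)"
  using keys_mult[of f g] by (fastforce simp: fhom_def)

lemma fhom_single: "word_par d w = p \<Longrightarrow> fhom d p (Poly_Mapping.single w c)"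
  by (auto simp: fhom_def)

lemma fhom_one: "fhom d 0 1"
  by (simp add: fhom_def)

lift_definition fpart ::
    "('g \<Rightarrow> bit) \<Rightarrow> bit \<Rightarrow> ('g fword \<Rightarrow>\<^sub>0 'b::zero) \<Rightarrow> ('g fword \<Rightarrow>\<^sub>0 'b)"
  is "\<lambda>d p f w. f w when word_par d w = p"
  by (rule finite_subset[rotated]) auto

lemma fpart_add: "fpart d p (f + g :: 'g falg) = fpart d p f + fpart d p g"
  by (rule poly_mapping_eqI) (auto simp: fpart.rep_eq lookup_add when_def)

lemma fpart_scale: "fpart d p (fscale c f) = fscale c (fpart d p f)"
  by (rule poly_mapping_eqI) (auto simp: fpart.rep_eq when_def)

lemma fpart_diff: "fpart d p (f - g :: 'g falg) = fpart d p f - fpart d p g"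
  by (rule poly_mapping_eqI) (auto simp: fpart.rep_eq lookup_minus when_def)

lemma fpart_fpart: "fpart d p (fpart d s f) = (if p = s then fpart d p f else 0)"
  by (rule poly_mapping_eqI) (auto simp: fpart.rep_eq when_def)

lemma fpart_sum: "fpart d 0 f + fpart d 1 f = f" for f :: "'g falg"
proof (rule poly_mapping_eqI)
  fix w
  show "Poly_Mapping.lookup (fpart d 0 f + fpart d 1 f) w = Poly_Mapping.lookup f w"
    by (cases "word_par d w") (auto simp: fpart.rep_eq when_def lookup_add)
qed

lemma fpart_fhom: "fhom d s f \<Longrightarrow> fpart d p f = (if p = s then f else 0)"
  by (rule poly_mapping_eqI) (auto simp: fpart.rep_eq when_def fhom_def in_keys_iff)

lemma fhom_fpart: "fhom d p (fpart d p f)"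
  by (auto simp: fhom_def fpart.rep_eq in_keys_iff)

lemma fscale_mult_left: "fscale c f * g = fscale c (f * g)"
  by (simp add: fscale_def mult_map_scale_conv_mult mult.assoc)

lemma fscale_mult_right: "f * fscale c g = fscale c (f * g)" for f :: "'g falg"
proof -
  have "f * Poly_Mapping.single 0 c = Poly_Mapping.single 0 c * f"
    by (induction f rule: free_induct) (simp_all add: mult_single distrib_left distrib_right mult.commute)
  then show ?thesis
    by (simp add: fscale_def mult_map_scale_conv_mult mult.assoc[symmetric])
qed

definition two_sided_ideal :: "'g falg set \<Rightarrow> 'g falg set"
  where "two_sided_ideal R = fspace.span {u * x * v | u x v. x \<in> R}"

lemma two_sided_ideal_mult:
  assumes "x \<in> two_sided_ideal R"
  shows "u * x * v \<in> two_sided_ideal R"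
  using assms unfolding two_sided_ideal_def
proof (induction rule: fspace.span_induct_alt)
  case base
  then show ?case by (simp add: fspace.span_zero)
next
  case (step c x y)
  then obtain u' r v' where x: "x = u' * r * v'" "r \<in> R" by blast
  have "u * x * v = (u * u') * r * (v' * v)" by (simp add: x mult.assoc)
  then have "u * x * v \<in> {u * x * v | u x v. x \<in> R}" using x(2) by blast
  moreover have "u * (fscale c x + y) * v = fscale c (u * x * v) + u * y * v"
    by (simp add: distrib_left distrib_right fscale_mult_left fscale_mult_right)
  ultimately show ?case
    using step(2) by (simp add: fspace.span_add fspace.span_scale fspace.span_base)
qed

lemmas two_sided_ideal_mult_left = two_sided_ideal_mult[where v = 1, simplified]
lemmas two_sided_ideal_mult_right = two_sided_ideal_mult[where u = 1, simplified]

lemma two_sided_ideal_base: "x \<in> R \<Longrightarrow> x \<in> two_sided_ideal R"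
  unfolding two_sided_ideal_def by (rule fspace.span_base) (force intro: exI[of _ 1])

lemma two_sided_ideal_fpart:
  fixes x :: "'a falg"
  assumes R: "\<And>r. r \<in> R \<Longrightarrow> \<exists>p. fhom d p r" and x: "x \<in> two_sided_ideal R"
  shows "fpart d p x \<in> two_sided_ideal R"
  using x unfolding two_sided_ideal_def
proof (induction rule: fspace.span_induct_alt)
  case base
  have "fpart d p (0 :: 'a falg) = 0" using fpart_diff[of d p "0 :: 'a falg" 0] by simp
  then show ?case by (simp add: fspace.span_zero)
next
  case (step c x y)
  then obtain u r v where x: "x = u * r * v" and r: "r \<in> R" by blast
  obtain s where s: "fhom d s r" using R r by blast
  have "fpart d p (u * r * v) \<in> fspace.span {u * x * v | u x v. x \<in> R}"
  proof (induction u rule: free_induct)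
    case (single w c)
    show ?case
    proof (induction v rule: free_induct)
      case (single w' c')
      have "fhom d (word_par d w + s + word_par d w') (Poly_Mapping.single w c * r * Poly_Mapping.single w' c')"
        using s by (intro fhom_mult fhom_single refl)
      then show ?case
        using r by (auto simp: fpart_fhom fspace.span_zero intro!: fspace.span_base)
    qed (simp add: distrib_left fpart_add fspace.span_add)
  qed (simp add: distrib_right fpart_add fspace.span_add)
  then show ?case
    using step(2) by (simp add: x fpart_add fpart_scale fspace.span_add fspace.span_scale)
qed

(* A type of generators together with their parities and a set of homogeneous relators. *)
class presentation =
  fixes gpar :: "'a \<Rightarrow> bit" and rels :: "'a falg set"
  assumes rels_fhom: "r \<in> rels \<Longrightarrow> \<exists>p. fhom gpar p r"

quotient_type (overloaded) 'g presented =
  "'g::presentation falg" / "\<lambda>x y. x - y \<in> two_sided_ideal rels"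
  unfolding two_sided_ideal_def by (rule span_equivp)

lemma ideal_simps:
  "x \<in> two_sided_ideal R \<Longrightarrow> y \<in> two_sided_ideal R \<Longrightarrow> x + y \<in> two_sided_ideal R"
  "x \<in> two_sided_ideal R \<Longrightarrow> y \<in> two_sided_ideal R \<Longrightarrow> x - y \<in> two_sided_ideal R"
  "x \<in> two_sided_ideal R \<Longrightarrow> - x \<in> two_sided_ideal R"
  "x \<in> two_sided_ideal R \<Longrightarrow> fscale c x \<in> two_sided_ideal R"
  "0 \<in> two_sided_ideal R"
  unfolding two_sided_ideal_def
  by (fact fspace.span_add fspace.span_diff fspace.span_neg fspace.span_scale fspace.span_zero)+

instantiation presented :: (presentation) superalgebra
begin

lift_definition zero_presented :: "'a presented" is 0 .

lift_definition one_presented :: "'a presented" is 1 .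

lift_definition plus_presented :: "'a presented \<Rightarrow> 'a presented \<Rightarrow> 'a presented" is "(+)"
  unfolding add_diff_add by (rule ideal_simps)

lift_definition uminus_presented :: "'a presented \<Rightarrow> 'a presented" is uminus
  unfolding minus_diff_minus by (rule ideal_simps)

lift_definition minus_presented :: "'a presented \<Rightarrow> 'a presented \<Rightarrow> 'a presented" is "(-)"
proof -
  fix a b c d :: "'a falg"
  assume "a - b \<in> two_sided_ideal rels" "c - d \<in> two_sided_ideal rels"
  then have "(a - b) - (c - d) \<in> two_sided_ideal rels" by (rule ideal_simps)
  moreover have "(a - b) - (c - d) = (a - c) - (b - d)" by (simp add: algebra_simps)
  ultimately show "(a - c) - (b - d) \<in> two_sided_ideal rels" by simp
qed

lift_definition scaleq_presented :: "cq \<Rightarrow> 'a presented \<Rightarrow> 'a presented" is fscale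
  unfolding fspace.scale_right_diff_distrib[symmetric] by (rule ideal_simps)

lift_definition times_presented :: "'a presented \<Rightarrow> 'a presented \<Rightarrow> 'a presented" is "(*)"
proof -
  fix a b c d :: "'a falg"
  assume "a - b \<in> two_sided_ideal rels" "c - d \<in> two_sided_ideal rels"
  then have "(a - b) * c + b * (c - d) \<in> two_sided_ideal rels"
    by (rule ideal_simps(1)[OF two_sided_ideal_mult_right two_sided_ideal_mult_left])
  moreover have "(a - b) * c + b * (c - d) = a * c - b * d" by (simp add: left_diff_distrib right_diff_distrib)
  ultimately show "a * c - b * d \<in> two_sided_ideal rels" by simp
qed

lift_definition hpart_presented :: "bit \<Rightarrow> 'a presented \<Rightarrow> 'a presented" is "fpart gpar"
  unfolding fpart_diff[symmetric] by (rule two_sided_ideal_fpart[OF rels_fhom])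

instance
proof
  have eq: "x - y \<in> two_sided_ideal R" if "x = y" for x y :: "'x falg" and R
    using that by (simp add: ideal_simps)
  fix a b c :: "'a presented" and k l :: cq and p s :: bit
  show "a + b + c = a + (b + c)" by (transfer, rule eq, rule add.assoc)
  show "a + b = b + a" by (transfer, rule eq, rule add.commute)
  show "0 + a = a" by (transfer, rule eq, rule add_0)
  show "- a + a = 0" by (transfer, rule eq, rule left_minus)
  show "a - b = a + - b" by (transfer, rule eq, rule diff_conv_add_uminus)
  show "k *\<^sub>q (a + b) = k *\<^sub>q a + k *\<^sub>q b"
    by (transfer, rule eq, rule fspace.scale_right_distrib)
  show "(k + l) *\<^sub>q a = k *\<^sub>q a + l *\<^sub>q a"
    by (transfer, rule eq, rule fspace.scale_left_distrib)
  show "k *\<^sub>q l *\<^sub>q a = (k * l) *\<^sub>q a" by (transfer, rule eq, rule fspace.scale_scale)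
  show "1 *\<^sub>q a = a" by (transfer, rule eq, rule fspace.scale_one)
  show "a * b * c = a * (b * c)" by (transfer, rule eq, rule mult.assoc)
  show "1 * a = a" by (transfer, rule eq, rule mult_1_left)
  show "a * 1 = a" by (transfer, rule eq, rule mult_1_right)
  show "(a + b) * c = a * c + b * c" by (transfer, rule eq, rule distrib_right)
  show "a * (b + c) = a * b + a * c" by (transfer, rule eq, rule distrib_left)
  show "(k *\<^sub>q a) * b = k *\<^sub>q (a * b)" by (transfer, rule eq, rule fscale_mult_left)
  show "a * (k *\<^sub>q b) = k *\<^sub>q (a * b)" by (transfer, rule eq, rule fscale_mult_right)
  show "hpart p (a + b) = hpart p a + hpart p b" by (transfer, rule eq, rule fpart_add)
  show "hpart p (k *\<^sub>q a) = k *\<^sub>q hpart p a" by (transfer, rule eq, rule fpart_scale)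
  have "hpart p (hpart p a) = hpart p a" for p by (transfer, rule eq) (simp add: fpart_fpart)
  moreover have "hpart p (hpart s a) = 0" if "p \<noteq> s"
    using that by (transfer, intro eq) (simp add: fpart_fpart)
  ultimately show "hpart p (hpart s a) = (if p = s then hpart p a else 0)" by simp
  show "hpart 0 a + hpart 1 a = a" by (transfer, rule eq, rule fpart_sum)
  show "hpart 0 (1 :: 'a presented) = 1"
    by (transfer, rule eq) (simp add: fpart_fhom[OF fhom_one])
  have "hpart (p + s) (hpart p a * hpart s b) = hpart p a * hpart s b"
    by (transfer, rule eq) (simp add: fpart_fhom[OF fhom_mult[OF fhom_fpart fhom_fpart]] del: add_bit_eq_xor)
  then show "hpart (p + s) (a * b) = a * b" if "hpart p a = a" "hpart s b = b"
    using that by simp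
qed

end

lift_definition pgen :: "'g \<Rightarrow> 'g::presentation presented" is fgen .


lemma presented_induct [case_names one scale mult add, induct type: presented]:
  assumes one: "P 1" and scale: "\<And>c x. P x \<Longrightarrow> P (c *\<^sub>q x)"
    and mult: "\<And>g x. P x \<Longrightarrow> P (pgen g * x)" and add: "\<And>x y. P x \<Longrightarrow> P y \<Longrightarrow> P (x + y)"
  shows "P x"
proof (induction x rule: presented.abs_induct)
  case (1 f)
  show ?case
  proof (induction f rule: free_induct)
    case (single w c)
    have "P (abs_presented (Poly_Mapping.single (Word l) 1))" for l :: "'a list"
    proof (induction l)
      case Nil
      then show ?case using one by (simp add: one_presented.abs_eq flip: zero_fword_def)
    next
      case (Cons g l)
      have "(Poly_Mapping.single (Word (g # l)) 1 :: 'a falg) = fgen g * Poly_Mapping.single (Word l) 1"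
        by (simp add: fgen_def mult_single plus_fword_def)
      then show ?case
        using mult[OF Cons, of g] by (simp add: pgen.abs_eq times_presented.abs_eq)
    qed
    then have "P (c *\<^sub>q abs_presented (Poly_Mapping.single (Word (letters w)) 1))" by (rule scale)
    then show ?case by (simp add: scaleq_presented.abs_eq)
  next
    case (add p r)
    then show ?case using assms(4) by (simp flip: plus_presented.abs_eq)
  qed
qed

(* Evaluation of elements of the free algebra in an algebra with scalar multiplication sc. *)
definition fa_eval :: "(cq \<Rightarrow> 'b \<Rightarrow> 'b) \<Rightarrow> ('g \<Rightarrow> 'b) \<Rightarrow> 'g falg \<Rightarrow> 'b::{ring, monoid_mult}"
  where "fa_eval sc f p =
    (\<Sum>w\<in>Poly_Mapping.keys p. sc (Poly_Mapping.lookup p w) (prod_list (map f (letters w))))"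

locale q_algebra = vector_space sc
  for sc :: "cq \<Rightarrow> 'b \<Rightarrow> 'b::{ring, monoid_mult}" +
  assumes sc_mult_left: "sc c x * y = sc c (x * y)" and sc_mult_right: "x * sc c y = sc c (x * y)"
begin

lemma fa_eval_single: "fa_eval sc f (Poly_Mapping.single w c) = sc c (prod_list (map f (letters w)))"
  by (simp add: fa_eval_def scale_zero_left)

lemma fa_eval_superset:
  assumes "finite A" "Poly_Mapping.keys p \<subseteq> A"
  shows "fa_eval sc f p = (\<Sum>w\<in>A. sc (Poly_Mapping.lookup p w) (prod_list (map f (letters w))))"
  unfolding fa_eval_def using assms
  by (intro sum.mono_neutral_left) (auto simp: in_keys_iff scale_zero_left)

lemma fa_eval_add: "fa_eval sc f (p + r) = fa_eval sc f p + fa_eval sc f r"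
proof -
  let ?A = "Poly_Mapping.keys p \<union> Poly_Mapping.keys r"
  have "Poly_Mapping.keys (p + r) \<subseteq> ?A" by (rule Poly_Mapping.keys_add)
  then show ?thesis
    using fa_eval_superset[of ?A "p + r" f] fa_eval_superset[of ?A p f] fa_eval_superset[of ?A r f]
    by (simp add: lookup_add scale_left_distrib sum.distrib)
qed

lemma fa_eval_scale: "fa_eval sc f (fscale c p) = sc c (fa_eval sc f p)"
proof (induction p rule: free_induct)
  case (single x d)
  then show ?case by (simp add: fa_eval_single scale_scale)
next
  case (add p r)
  then show ?case
    by (simp add: fa_eval_add fspace.scale_right_distrib scale_right_distrib)
qed

lemma fa_eval_mult: "fa_eval sc f (p * r) = fa_eval sc f p * fa_eval sc f r"
proof (induction p rule: free_induct)
  case (single x c)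
  show ?case
  proof (induction r rule: free_induct)
    case (single y d)
    then show ?case
      by (simp add: fa_eval_single mult_single plus_fword_def sc_mult_left sc_mult_right
          scale_scale)
  qed (simp add: fa_eval_add distrib_left)
qed (simp add: fa_eval_add distrib_right)

lemma fa_eval_0: "fa_eval sc f 0 = 0"
  by (simp add: fa_eval_def)

lemma fa_eval_1: "fa_eval sc f (1 :: 'c falg) = 1"
proof -
  have "Poly_Mapping.single (Word []) 1 = (1 :: 'c falg)" by (simp flip: zero_fword_def)
  then show ?thesis using fa_eval_single[of f "Word []" 1] by simp
qed

lemma fa_eval_gen: "fa_eval sc f (fgen g) = f g"
  by (simp add: fgen_def fa_eval_single scale_one)

lemma fa_eval_diff: "fa_eval sc f (p - r) = fa_eval sc f p - fa_eval sc f r"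
  using fa_eval_add[of f "p - r" r] by simp

lemma fa_eval_sum: "fa_eval sc f (\<Sum>i\<in>I. p i) = (\<Sum>i\<in>I. fa_eval sc f (p i))"
  by (induction I rule: infinite_finite_induct) (simp_all add: fa_eval_0 fa_eval_add)

lemma fa_eval_ideal:
  assumes R: "\<And>r. r \<in> R \<Longrightarrow> fa_eval sc f r = 0" and x: "x \<in> two_sided_ideal R"
  shows "fa_eval sc f x = 0"
  using x unfolding two_sided_ideal_def
proof (induction rule: fspace.span_induct_alt)
  case (step c x y)
  then show ?case
    by (auto simp: fa_eval_add fa_eval_scale fa_eval_mult R scale_zero_right)
qed (rule fa_eval_0)

end

(* The algebra homomorphism determined by the images f g of the generators; it is
   meaningful when f respects the relators. *)
definition induced :: "(cq \<Rightarrow> 'b \<Rightarrow> 'b) \<Rightarrow> ('g \<Rightarrow> 'b) \<Rightarrow> 'g::presentation presented \<Rightarrow> 'b::{ring, monoid_mult}"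
  where "induced sc f x = fa_eval sc f (rep_presented x)"

locale respecting = q_algebra sc for sc :: "cq \<Rightarrow> 'b \<Rightarrow> 'b::{ring, monoid_mult}" +
  fixes f :: "'g::presentation \<Rightarrow> 'b"
  assumes respects: "r \<in> rels \<Longrightarrow> fa_eval sc f r = 0"
begin

lemma induced_abs: "induced sc f (abs_presented p) = fa_eval sc f p"
proof -
  have "rep_presented (abs_presented p) - p \<in> two_sided_ideal rels"
    using rep_abs_rsp_left[OF Quotient3_presented, of p p] by (simp add: ideal_simps)
  then have "fa_eval sc f (rep_presented (abs_presented p) - p) = 0"
    by (rule fa_eval_ideal[rotated]) (rule respects)
  then show ?thesis by (simp add: induced_def fa_eval_diff)
qed

lemma induced_add: "induced sc f (x + y) = induced sc f x + induced sc f y"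
  by (induction x rule: presented.abs_induct; induction y rule: presented.abs_induct)
    (simp add: plus_presented.abs_eq induced_abs fa_eval_add)

lemma induced_mult: "induced sc f (x * y) = induced sc f x * induced sc f y"
  by (induction x rule: presented.abs_induct; induction y rule: presented.abs_induct)
    (simp add: times_presented.abs_eq induced_abs fa_eval_mult)

lemma induced_scale: "induced sc f (c *\<^sub>q x) = sc c (induced sc f x)"
  by (induction x rule: presented.abs_induct)
    (simp add: scaleq_presented.abs_eq induced_abs fa_eval_scale)

lemma induced_1: "induced sc f 1 = 1"
  by (simp add: one_presented.abs_eq induced_abs fa_eval_1)

lemma induced_gen: "induced sc f (pgen g) = f g"
  by (simp add: pgen.abs_eq induced_abs fa_eval_gen)

end


section \<open>Index sets and the matrix S\<close>

(* I_{n|n} = {-n, ..., -1, 1, ..., n} with n = CARD('n) *)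
typedef ('n::finite) idx = "{i::int. i \<noteq> 0 \<and> \<bar>i\<bar> \<le> int CARD('n)}"
  morphisms int_of_idx Abs_idx
  by (rule exI[of _ 1]) (simp add: Suc_le_eq)

setup_lifting type_definition_idx

instantiation idx :: (finite) "{linorder, uminus}"
begin

lift_definition less_eq_idx :: "'a idx \<Rightarrow> 'a idx \<Rightarrow> bool" is "(\<le>)" .

lift_definition less_idx :: "'a idx \<Rightarrow> 'a idx \<Rightarrow> bool" is "(<)" .

lift_definition uminus_idx :: "'a idx \<Rightarrow> 'a idx" is uminus
  by simp

instance by standard (transfer; auto)+

end

instance idx :: (finite) finite
proof
  have "finite {i::int. i \<noteq> 0 \<and> \<bar>i\<bar> \<le> int CARD('a)}"
    by (rule finite_subset[of _ "{- int CARD('a)..int CARD('a)}"]) auto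
  then have "finite (Abs_idx ` {i::int. i \<noteq> 0 \<and> \<bar>i\<bar> \<le> int CARD('a)} :: 'a idx set)"
    by simp
  moreover have "UNIV = (Abs_idx ` {i::int. i \<noteq> 0 \<and> \<bar>i\<bar> \<le> int CARD('a)} :: 'a idx set)"
    by (rule type_definition.univ[OF type_definition_idx])
  ultimately show "finite (UNIV :: 'a idx set)" by simp
qed

lemma minus_minus_idx [simp]: "- (- i) = i" for i :: "'n::finite idx"
  by transfer simp

lift_definition ipar :: "'n::finite idx \<Rightarrow> bit" is "\<lambda>i. if 0 < i then 0 else 1" .

lemma ipar_uminus [simp]: "ipar (- i) = ipar i + 1"
  by transfer auto

(* The positive indices 1, ..., r with r = CARD('r). *)
typedef ('r::finite) pidx = "{1..int CARD('r)}"
  morphisms int_of_pidx Abs_pidx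
  by (rule exI[of _ 1]) (simp add: Suc_le_eq)

setup_lifting type_definition_pidx

instantiation pidx :: (finite) linorder
begin

lift_definition less_eq_pidx :: "'a pidx \<Rightarrow> 'a pidx \<Rightarrow> bool" is "(\<le>)" .

lift_definition less_pidx :: "'a pidx \<Rightarrow> 'a pidx \<Rightarrow> bool" is "(<)" .

instance by standard (transfer; auto)+

end

definition phi :: "'n::finite idx \<Rightarrow> 'n idx \<Rightarrow> int"
  where "phi i j = (if ipar j = 0 then 1 else -1) * (of_bool (i = j) + of_bool (i = - j))"

(* S = sum of Smat a b c d times E_ab \<otimes> E_cd: the first summand collects the terms
   q^phi(i,j) E_ii \<otimes> E_jj, the second the terms (-1)^|i| xi (E_ji + E_{-j,-i}) \<otimes> E_ij, i < j. *)
definition Smat :: "'n::finite idx \<Rightarrow> 'n idx \<Rightarrow> 'n idx \<Rightarrow> 'n idx \<Rightarrow> cq"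
  where "Smat a b c d =
    (if a = b \<and> c = d then qq powi phi a c else 0)
    + (if c < d then xi * koszul (ipar c) * (of_bool (a = d \<and> b = c) + of_bool (a = - d \<and> b = - c)) else 0)"

lemma Smat_support:
  "Smat a b c d \<noteq> 0 \<Longrightarrow> a = b \<and> c = d \<or> a = d \<and> b = c \<or> a = - d \<and> b = - c"
proof (rule ccontr)
  assume nz: "Smat a b c d \<noteq> 0" and "\<not> (a = b \<and> c = d \<or> a = d \<and> b = c \<or> a = - d \<and> b = - c)"
  then have "(a = b \<and> c = d) = False" "(a = d \<and> b = c) = False" "(a = - d \<and> b = - c) = False"
    by blast+
  then have "Smat a b c d = 0"
    unfolding Smat_def by (simp only: if_False of_bool_eq add_0_right mult_zero_right if_cancel)
  with nz show False by contradiction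
qed

lemma Smat_even:
  assumes "Smat a b c d \<noteq> 0"
  shows "ipar a + ipar b + ipar c + ipar d = 0"
  using Smat_support[OF assms]
  by (elim disjE conjE; hypsubst; cases "ipar c"; cases "ipar d"; cases "ipar b"; simp)


section \<open>The quantum queer superalgebra\<close>

(* The pairs (i, j) with i \<le> j, indexing the generators L_ij. *)
typedef ('n::finite) lgen = "{(i::'n idx, j::'n idx). i \<le> j}"
  by (rule exI[of _ "(undefined, undefined)"]) simp

definition fL :: "'n::finite idx \<Rightarrow> 'n idx \<Rightarrow> 'n lgen falg"
  where "fL i j = (if i \<le> j then fgen (Abs_lgen (i, j)) else 0)"

(* The coefficient of E_ib \<otimes> E_kd in L^{[1]2} L^{[1]3} S^{23} - S^{23} L^{[1]3} L^{[1]2}.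
   By the Koszul rule, and as Smat a b c d = 0 unless |a|+|b| = |c|+|d|,
     L^{[1]2} L^{[1]3} S^{23} = sum of (-1)^((|i|+|j|)(|k|+|l|)) L_ij L_kl \<otimes> E_ij \<otimes> E_kl times Smat j b l d 1 \<otimes> E_jb \<otimes> E_ld,
   where moving E_kl past E_jb gives the further sign (-1)^((|k|+|l|)(|j|+|b|)); and
     L^{[1]3} L^{[1]2} = sum of L_ld L_jb \<otimes> E_jb \<otimes> E_ld
   carries no sign, while in Smat i j k l (1 \<otimes> E_ij \<otimes> E_kl) (L_ld L_jb \<otimes> E_jb \<otimes> E_ld) moving E_kl past E_jb
   gives (-1)^((|k|+|l|)(|j|+|b|)). *)
definition rll_rel :: "'n::finite idx \<Rightarrow> 'n idx \<Rightarrow> 'n idx \<Rightarrow> 'n idx \<Rightarrow> 'n lgen falg"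
  where "rll_rel i b k d =
    (\<Sum>j\<in>UNIV. \<Sum>l\<in>UNIV.
      fscale (koszul ((ipar i + ipar j) * (ipar k + ipar l) + (ipar k + ipar l) * (ipar j + ipar b)) * Smat j b l d)
        (fL i j * fL k l))
    - (\<Sum>j\<in>UNIV. \<Sum>l\<in>UNIV.
      fscale (koszul ((ipar k + ipar l) * (ipar j + ipar b)) * Smat i j k l) (fL l d * fL j b))"

definition lgen_par :: "'n::finite lgen \<Rightarrow> bit"
  where "lgen_par g = (case Rep_lgen g of (i, j) \<Rightarrow> ipar i + ipar j)"

definition lgen_rels :: "'n::finite lgen falg set"
  where "lgen_rels = {fL i i * fL (- i) (- i) - 1 | i. True} \<union> {rll_rel i b k d | i b k d. True}"

lemma fhom_fgen: "d g = p \<Longrightarrow> fhom d p (fgen g)"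
  unfolding fgen_def by (rule fhom_single) simp

lemma fhom_fL: "fhom lgen_par (ipar i + ipar j) (fL i j)"
  by (auto simp: fL_def lgen_par_def Abs_lgen_inverse intro!: fhom_fgen)

lemma fhom_fL_mult:
  "ipar i + ipar j + (ipar k + ipar l) = p \<Longrightarrow> fhom lgen_par p (fL i j * fL k l)"
  using fhom_mult[OF fhom_fL fhom_fL] by blast

instantiation lgen :: (finite) presentation
begin

definition gpar_lgen :: "'a lgen \<Rightarrow> bit" where "gpar_lgen = lgen_par"

definition rels_lgen :: "'a lgen falg set" where "rels_lgen = lgen_rels"

instance
proof
  fix r :: "'a lgen falg"
  assume "r \<in> rels"
  then consider i where "r = fL i i * fL (- i) (- i) - 1" | i b k d where "r = rll_rel i b k d"
    by (auto simp: rels_lgen_def lgen_rels_def)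
  then show "\<exists>p. fhom gpar p r"
  proof cases
    case 1
    then show ?thesis
      by (auto simp: gpar_lgen_def intro!: exI[of _ 0] fhom_diff fhom_fL_mult fhom_one)
  next
    case (2 i b k d)
    let ?p = "ipar i + ipar b + (ipar k + ipar d)"
    have "fhom lgen_par ?p (fscale (c * Smat j b l d) (fL i j * fL k l))" for c j l
    proof (cases "Smat j b l d = 0")
      case False
      have "ipar i + ipar j + (ipar k + ipar l) = ?p"
        using Smat_even[OF False]
        by (cases "ipar i"; cases "ipar b"; cases "ipar k"; cases "ipar d"; cases "ipar j"; cases "ipar l") simp_all
      then show ?thesis by (intro fhom_scale fhom_fL_mult)
    qed simp
    moreover have "fhom lgen_par ?p (fscale (c * Smat i j k l) (fL l d * fL j b))" for c j l
    proof (cases "Smat i j k l = 0")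
      case False
      have "ipar l + ipar d + (ipar j + ipar b) = ?p"
        using Smat_even[OF False]
        by (cases "ipar i"; cases "ipar b"; cases "ipar k"; cases "ipar d"; cases "ipar j"; cases "ipar l") simp_all
      then show ?thesis by (intro fhom_scale fhom_fL_mult)
    qed simp
    ultimately have "fhom lgen_par ?p r"
      unfolding 2 rll_rel_def by (intro fhom_diff fhom_sum)
    then show ?thesis by (auto simp: gpar_lgen_def)
  qed
qed

end

(* U_q(q_n) with n = CARD('n) *)
type_synonym 'n Uq = "'n lgen presented"

definition LU :: "'n::finite idx \<Rightarrow> 'n idx \<Rightarrow> 'n Uq"
  where "LU i j = (if i \<le> j then pgen (Abs_lgen (i, j)) else 0)"

definition comult_gen :: "'n::finite idx \<Rightarrow> 'n idx \<Rightarrow> 'n Uq \<otimes> 'n Uq"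
  where "comult_gen i j =
    (\<Sum>k\<in>UNIV. koszul ((ipar i + ipar k) * (ipar k + ipar j)) *\<^sub>q (LU i k \<otimes> LU k j))"

definition comult :: "'n::finite Uq \<Rightarrow> 'n Uq \<otimes> 'n Uq"
  where "comult = induced scaleq (\<lambda>g. case Rep_lgen g of (i, j) \<Rightarrow> comult_gen i j)"

definition counit :: "'n::finite Uq \<Rightarrow> cq"
  where "counit = induced (*) (\<lambda>g. case Rep_lgen g of (i, j) \<Rightarrow> of_bool (i = j))"


lemma q_algebra_scaleq: "q_algebra (scaleq :: cq \<Rightarrow> 'a::superalgebra \<Rightarrow> 'a)"
  by standard (simp_all add: scaleq_mult_left scaleq_mult_right)

lemma q_algebra_cq: "q_algebra ((*) :: cq \<Rightarrow> cq \<Rightarrow> cq)"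
  by standard (simp_all add: algebra_simps)

lemma LU_abs: "LU i j = abs_presented (fL i j)"
  by (simp add: LU_def fL_def pgen.abs_eq zero_presented.abs_eq)

lemma hpart_LU: "hpart (ipar i + ipar j) (LU i j) = LU i j"
  by (simp only: LU_abs hpart_presented.abs_eq gpar_lgen_def fpart_fhom[OF fhom_fL] if_True refl)

lemma abs_presented_rels: "r \<in> rels \<Longrightarrow> abs_presented r = 0"
  by (simp add: zero_presented.abs_eq presented.abs_eq_iff two_sided_ideal_base)

lemma abs_presented_sum: "abs_presented (sum f I) = (\<Sum>i\<in>I. abs_presented (f i))"
  by (induction I rule: infinite_finite_induct)
    (simp_all add: zero_presented.abs_eq plus_presented.abs_eq[symmetric])

lemma LU_inverse: "LU i i * LU (- i) (- i) = 1"
proof -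
  have "fL i i * fL (- i) (- i) - 1 \<in> rels"
    by (auto simp: rels_lgen_def lgen_rels_def)
  from abs_presented_rels[OF this] show ?thesis
    by (simp add: LU_abs times_presented.abs_eq minus_presented.abs_eq[symmetric] one_presented.abs_eq)
qed

lemma rll_sign:
  "koszul ((ipar i + ipar j) * (ipar k + ipar l) + (ipar k + ipar l) * (ipar j + ipar b))
    = koszul ((ipar k + ipar l) * (ipar i + ipar b))"
  by (cases "ipar i"; cases "ipar j"; cases "ipar k"; cases "ipar l"; cases "ipar b") simp_all

lemma RLL:
  "(\<Sum>j\<in>UNIV. \<Sum>l\<in>UNIV. (koszul ((ipar k + ipar l) * (ipar i + ipar b)) * Smat j b l d) *\<^sub>q (LU i j * LU k l))
   = (\<Sum>j\<in>UNIV. \<Sum>l\<in>UNIV. (koszul ((ipar k + ipar l) * (ipar j + ipar b)) * Smat i j k l) *\<^sub>q (LU l d * LU j b))"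
proof -
  have "rll_rel i b k d \<in> rels" unfolding rels_lgen_def lgen_rels_def by blast
  from abs_presented_rels[OF this, unfolded rll_rel_def rll_sign] show ?thesis
    by (simp add: LU_abs minus_presented.abs_eq[symmetric] abs_presented_sum
        times_presented.abs_eq scaleq_presented.abs_eq)
qed

lemma fa_eval_fL:
  assumes "q_algebra sc"
  shows "fa_eval sc f (fL i j) = (if i \<le> j then f (Abs_lgen (i, j)) else 0)"
  using assms by (simp add: fL_def q_algebra.fa_eval_gen q_algebra.fa_eval_0)

lemma fa_eval_rll_rel:
  assumes "q_algebra sc"
  shows "fa_eval sc f (rll_rel i b k d) =
    (\<Sum>j\<in>UNIV. \<Sum>l\<in>UNIV. sc (koszul ((ipar k + ipar l) * (ipar i + ipar b)) * Smat j b l d)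
       (fa_eval sc f (fL i j) * fa_eval sc f (fL k l)))
    - (\<Sum>j\<in>UNIV. \<Sum>l\<in>UNIV. sc (koszul ((ipar k + ipar l) * (ipar j + ipar b)) * Smat i j k l)
       (fa_eval sc f (fL l d) * fa_eval sc f (fL j b)))"
  unfolding rll_rel_def rll_sign
  by (simp add: q_algebra.fa_eval_diff[OF assms] q_algebra.fa_eval_sum[OF assms]
      q_algebra.fa_eval_scale[OF assms] q_algebra.fa_eval_mult[OF assms])

lemma respecting_lgenI:
  assumes "q_algebra sc"
    and "\<And>i. fa_eval sc f (fL i i) * fa_eval sc f (fL (- i) (- i)) = 1"
    and "\<And>i b k d. fa_eval sc f (rll_rel i b k d) = 0"
  shows "respecting sc (f :: 'n::finite lgen \<Rightarrow> _)"
proof -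
  interpret q_algebra sc by fact
  show ?thesis
    by standard (auto simp: rels_lgen_def lgen_rels_def fa_eval_diff fa_eval_mult fa_eval_1 assms)
qed

global_interpretation counit: respecting "(*)" "\<lambda>g::'n::finite lgen. case Rep_lgen g of (i, j) \<Rightarrow> of_bool (i = j)"
proof (rule respecting_lgenI[OF q_algebra_cq])
  let ?e = "fa_eval (*) (\<lambda>g::'n lgen. case Rep_lgen g of (i, j) \<Rightarrow> of_bool (i = j)) :: _ \<Rightarrow> cq"
  have e: "?e (fL i j) = of_bool (i = j)" for i j
    by (auto simp: fa_eval_fL[OF q_algebra_cq] Abs_lgen_inverse)
  show "?e (fL i i) * ?e (fL (- i) (- i)) = 1" for i
    by (simp add: e)
  have s: "(\<Sum>j\<in>UNIV. \<Sum>l\<in>UNIV. (c j l :: cq) * (of_bool (i = j) * of_bool (k = l))) = c i k"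
    for c and i k :: "'n idx"
    by (simp add: of_bool_def if_distrib[where f = "(*) _"] sum.If_cases cong: if_cong)
  have s': "(\<Sum>j\<in>UNIV. \<Sum>l\<in>UNIV. (c j l :: cq) * (of_bool (l = d) * of_bool (j = b))) = c b d"
    for c and b d :: "'n idx"
    using s[of c b d] by (simp add: eq_commute mult.commute)
  show "?e (rll_rel i b k d) = 0" for i b k d
  proof (cases "Smat i b k d = 0")
    case False
    show ?thesis
      unfolding fa_eval_rll_rel[OF q_algebra_cq] e s s' by (simp add: add.commute)
  qed (unfold fa_eval_rll_rel[OF q_algebra_cq] e s s', simp)
qed

lemma counit_LU: "counit (LU i j) = of_bool (i = j)"
  by (auto simp: counit_def LU_abs counit.induced_abs fa_eval_fL[OF q_algebra_cq] Abs_lgen_inverse)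

lemmas counit_hom = counit.induced_add[folded counit_def] counit.induced_scale[folded counit_def]
  counit.induced_mult[folded counit_def] counit.induced_1[folded counit_def]

lemma comult_gen_mult:
  "comult_gen i j * comult_gen k l = (\<Sum>a\<in>UNIV. \<Sum>c\<in>UNIV.
    koszul ((ipar i + ipar a) * (ipar a + ipar j) + (ipar k + ipar c) * (ipar c + ipar l)
      + (ipar a + ipar j) * (ipar k + ipar c)) *\<^sub>q ((LU i a * LU k c) \<otimes> (LU a j * LU c l)))"
  unfolding comult_gen_def sum_product
  by (simp only: scaleq_mult_left scaleq_mult_right times_tens_hom[OF hpart_LU hpart_LU]
      scaleq_scaleq koszul_add mult.assoc mult.commute mult.left_commute)

lemma comult_gen_0: "\<not> i \<le> j \<Longrightarrow> comult_gen i j = 0"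
  unfolding comult_gen_def by (rule sum.neutral) (auto simp: LU_def)

lemma tens_sum_right: "a \<otimes> (\<Sum>i\<in>I. f i) = (\<Sum>i\<in>I. a \<otimes> f i)"
  by (induction I rule: infinite_finite_induct) (simp_all add: tens_simps)

lemma tens_sum_left: "(\<Sum>i\<in>I. f i) \<otimes> b = (\<Sum>i\<in>I. f i \<otimes> b)"
  by (induction I rule: infinite_finite_induct) (simp_all add: tens_simps)

lemma sum_swap4:
  "(\<Sum>j\<in>A. \<Sum>l\<in>B. \<Sum>a\<in>C. \<Sum>c\<in>D. f j l a c) = (\<Sum>a\<in>C. \<Sum>c\<in>D. \<Sum>j\<in>A. \<Sum>l\<in>B. f j l a c)"
proof -
  have "(\<Sum>j\<in>A. \<Sum>l\<in>B. \<Sum>a\<in>C. \<Sum>c\<in>D. f j l a c) = (\<Sum>j\<in>A. \<Sum>a\<in>C. \<Sum>c\<in>D. \<Sum>l\<in>B. f j l a c)"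
    by (intro sum.cong refl) (subst sum.swap, intro sum.cong refl, subst sum.swap, rule refl)
  also have "\<dots> = (\<Sum>a\<in>C. \<Sum>c\<in>D. \<Sum>j\<in>A. \<Sum>l\<in>B. f j l a c)"
    by (subst sum.swap, intro sum.cong refl, subst sum.swap, rule refl)
  finally show ?thesis .
qed

lemma comult_sign1:
  fixes i k a c j l b d :: bit
  assumes "j + b + l + d = 0"
  shows "koszul ((k + l) * (i + b)) * koszul ((i + a) * (a + j) + (k + c) * (c + l) + (a + j) * (k + c))
    = koszul ((k + c) * (i + a) + (k + c) * (c + d) + (i + a) * (c + d) + (i + a) * (a + b))
      * koszul ((c + l) * (a + b))"
  using assms
  by (cases i; cases k; cases a; cases c; cases j; cases l; cases b; cases d) simp_all

lemma comult_sign2: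
  fixes i k a c j l b d :: bit
  assumes "i + j + k + l = 0"
  shows "koszul ((k + l) * (j + b)) * koszul ((l + c) * (c + d) + (j + a) * (a + b) + (c + d) * (j + a))
    = koszul ((k + c) * (c + d) + (i + a) * (a + b) + (c + d) * (i + a)) * koszul ((k + l) * (j + a))"
  using assms
  by (cases i; cases k; cases a; cases c; cases j; cases l; cases b; cases d) simp_all

lemma comult_sign3:
  fixes i k a c j l b d :: bit
  assumes "a + j + c + l = 0"
  shows "koszul ((k + c) * (i + a) + (k + c) * (c + d) + (i + a) * (c + d) + (i + a) * (a + b))
      * koszul ((c + l) * (j + b))
    = koszul ((k + l) * (l + d) + (i + j) * (j + b) + (l + d) * (i + j)) * koszul ((k + c) * (i + j))"
  using assms
  by (cases i; cases k; cases a; cases c; cases j; cases l; cases b; cases d) simp_all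

lemma comult_gen_RLL:
  "(\<Sum>j\<in>UNIV. \<Sum>l\<in>UNIV. (koszul ((ipar k + ipar l) * (ipar i + ipar b)) * Smat j b l d)
      *\<^sub>q (comult_gen i j * comult_gen k l))
   = (\<Sum>j\<in>UNIV. \<Sum>l\<in>UNIV. (koszul ((ipar k + ipar l) * (ipar j + ipar b)) * Smat i j k l)
      *\<^sub>q (comult_gen l d * comult_gen j b))"
  (is "?lhs = ?rhs")
proof -
  let ?A = "\<lambda>a c. koszul ((ipar k + ipar c) * (ipar i + ipar a) + (ipar k + ipar c) * (ipar c + ipar d)
      + (ipar i + ipar a) * (ipar c + ipar d) + (ipar i + ipar a) * (ipar a + ipar b))"
  let ?B = "\<lambda>a c. koszul ((ipar k + ipar c) * (ipar c + ipar d) + (ipar i + ipar a) * (ipar a + ipar b)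
      + (ipar c + ipar d) * (ipar i + ipar a))"
  have "?lhs = (\<Sum>j\<in>UNIV. \<Sum>l\<in>UNIV. \<Sum>a\<in>UNIV. \<Sum>c\<in>UNIV.
      ?A a c *\<^sub>q (LU i a * LU k c) \<otimes> ((koszul ((ipar c + ipar l) * (ipar a + ipar b)) * Smat j b l d) *\<^sub>q (LU a j * LU c l)))"
    unfolding comult_gen_mult qspace.scale_sum_right
  proof (intro sum.cong refl, goal_cases)
    case (1 j l a c)
    show ?case
    proof (cases "Smat j b l d = 0")
      case False
      show ?thesis
        using arg_cong[OF comult_sign1[OF Smat_even[OF False], of "ipar k" "ipar i" "ipar a" "ipar c"], of "\<lambda>x. x * Smat j b l d"]
        unfolding tens_simps scaleq_scaleq by (simp only: mult_ac)
    qed simp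
  qed
  also have "\<dots> = (\<Sum>a\<in>UNIV. \<Sum>c\<in>UNIV. ?A a c *\<^sub>q (LU i a * LU k c) \<otimes>
      (\<Sum>j\<in>UNIV. \<Sum>l\<in>UNIV. (koszul ((ipar c + ipar l) * (ipar a + ipar b)) * Smat j b l d) *\<^sub>q (LU a j * LU c l)))"
    by (subst sum_swap4) (simp only: tens_sum_right)
  also have "\<dots> = (\<Sum>a\<in>UNIV. \<Sum>c\<in>UNIV. ?A a c *\<^sub>q (LU i a * LU k c) \<otimes>
      (\<Sum>j\<in>UNIV. \<Sum>l\<in>UNIV. (koszul ((ipar c + ipar l) * (ipar j + ipar b)) * Smat a j c l) *\<^sub>q (LU l d * LU j b)))"
    unfolding RLL ..
  also have "\<dots> = (\<Sum>a\<in>UNIV. \<Sum>c\<in>UNIV. \<Sum>j\<in>UNIV. \<Sum>l\<in>UNIV.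
      (?B j l *\<^sub>q (koszul ((ipar k + ipar c) * (ipar i + ipar j)) * Smat a j c l) *\<^sub>q (LU i a * LU k c)) \<otimes> (LU l d * LU j b))"
    unfolding tens_sum_right
  proof (intro sum.cong refl, goal_cases)
    case (1 a c j l)
    show ?case
    proof (cases "Smat a j c l = 0")
      case False
      show ?thesis
        using arg_cong[OF comult_sign3[OF Smat_even[OF False], of "ipar k" "ipar i" "ipar d" "ipar b"], of "\<lambda>x. x * Smat a j c l"]
        unfolding tens_simps scaleq_scaleq by (simp only: mult_ac)
    qed simp
  qed
  also have "\<dots> = (\<Sum>j\<in>UNIV. \<Sum>l\<in>UNIV. (?B j l *\<^sub>q (\<Sum>a\<in>UNIV. \<Sum>c\<in>UNIV.
      (koszul ((ipar k + ipar c) * (ipar i + ipar j)) * Smat a j c l) *\<^sub>q (LU i a * LU k c))) \<otimes> (LU l d * LU j b))"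
    by (subst sum_swap4) (simp only: tens_sum_left qspace.scale_sum_right)
  also have "\<dots> = (\<Sum>j\<in>UNIV. \<Sum>l\<in>UNIV. (?B j l *\<^sub>q (\<Sum>a\<in>UNIV. \<Sum>c\<in>UNIV.
      (koszul ((ipar k + ipar c) * (ipar a + ipar j)) * Smat i a k c) *\<^sub>q (LU c l * LU a j))) \<otimes> (LU l d * LU j b))"
    unfolding RLL ..
  also have "\<dots> = (\<Sum>a\<in>UNIV. \<Sum>c\<in>UNIV. \<Sum>j\<in>UNIV. \<Sum>l\<in>UNIV.
      (?B j l *\<^sub>q (koszul ((ipar k + ipar c) * (ipar a + ipar j)) * Smat i a k c) *\<^sub>q (LU c l * LU a j)) \<otimes> (LU l d * LU j b))"
    by (subst sum_swap4) (simp only: tens_sum_left qspace.scale_sum_right)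
  also have "\<dots> = (\<Sum>a\<in>UNIV. \<Sum>c\<in>UNIV. (koszul ((ipar k + ipar c) * (ipar a + ipar b)) * Smat i a k c)
      *\<^sub>q (comult_gen c d * comult_gen a b))"
  proof (intro sum.cong refl, goal_cases)
    case (1 a c)
    have "comult_gen c d * comult_gen a b = (\<Sum>j\<in>UNIV. \<Sum>l\<in>UNIV.
      koszul ((ipar c + ipar l) * (ipar l + ipar d) + (ipar a + ipar j) * (ipar j + ipar b)
      + (ipar l + ipar d) * (ipar a + ipar j)) *\<^sub>q ((LU c l * LU a j) \<otimes> (LU l d * LU j b)))"
      unfolding comult_gen_mult by (rule sum.swap)
    then show ?case unfolding qspace.scale_sum_right
    proof (simp only: qspace.scale_sum_right, intro sum.cong refl, goal_cases)
      case (1 j l)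
      show ?case
      proof (cases "Smat i a k c = 0")
        case False
        show ?thesis
          using arg_cong[OF comult_sign2[OF Smat_even[OF False], of "ipar b" "ipar l" "ipar d" "ipar j"], of "\<lambda>x. x * Smat i a k c"]
          unfolding tens_simps scaleq_scaleq by (simp only: mult_ac)
      qed simp
    qed
  qed
  finally show ?thesis .
qed

global_interpretation comult: respecting scaleq "\<lambda>g::'n::finite lgen. case Rep_lgen g of (i, j) \<Rightarrow> comult_gen i j"
proof (rule respecting_lgenI[OF q_algebra_scaleq])
  let ?e = "fa_eval scaleq (\<lambda>g::'n lgen. case Rep_lgen g of (i, j) \<Rightarrow> comult_gen i j)"
  have e: "?e (fL i j) = comult_gen i j" for i j
    by (auto simp: fa_eval_fL[OF q_algebra_scaleq] Abs_lgen_inverse comult_gen_0)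
  have diag: "comult_gen i i = LU i i \<otimes> LU i i" for i :: "'n idx"
  proof -
    have "comult_gen i i = (\<Sum>k\<in>{i}. koszul ((ipar i + ipar k) * (ipar k + ipar i)) *\<^sub>q (LU i k \<otimes> LU k i))"
      unfolding comult_gen_def by (rule sum.mono_neutral_right) (auto simp: LU_def)
    then show ?thesis by (simp add: scaleq_one)
  qed
  show "?e (fL i i) * ?e (fL (- i) (- i)) = 1" for i
    using times_tens_hom[of 0 "LU i i" 0 "LU (- i) (- i)" "LU i i" "LU (- i) (- i)"]
      hpart_LU[of i i] hpart_LU[of "- i" "- i"]
    by (simp add: e diag LU_inverse one_tensor_def scaleq_one)
  show "?e (rll_rel i b k d) = 0" for i b k d
    unfolding fa_eval_rll_rel[OF q_algebra_scaleq] e comult_gen_RLL by simp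
qed

lemma comult_LU: "comult (LU i j) = comult_gen i j"
  by (auto simp: comult_def LU_abs comult.induced_abs fa_eval_fL[OF q_algebra_scaleq]
      Abs_lgen_inverse comult_gen_0)

lemmas comult_hom = comult.induced_add[folded comult_def] comult.induced_scale[folded comult_def]
  comult.induced_mult[folded comult_def] comult.induced_1[folded comult_def]


section \<open>The quantum coordinate superalgebra\<close>

datatype ('r, 'n) tgen = TGen "'r pidx" "'n idx"

definition ft :: "'r::finite pidx \<Rightarrow> 'n::finite idx \<Rightarrow> ('r, 'n) tgen falg"
  where "ft i a = fgen (TGen i a)"

primrec tgen_par :: "('r::finite, 'n::finite) tgen \<Rightarrow> bit"
  where "tgen_par (TGen i a) = ipar a"

definition tgen_rels :: "('r::finite, 'n::finite) tgen falg set"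
  where "tgen_rels =
    {fscale (qq ^ of_bool (i = j)) (ft i a * ft j b)
     - fscale (koszul (ipar a * ipar b) * qq powi phi a b) (ft j b * ft i a)
     - (fscale (xi * (of_bool (a < b) - of_bool (j < i))) (ft j a * ft i b)
        + fscale (koszul (ipar b) * xi * of_bool (- a < b)) (ft j (- a) * ft i (- b)))
     | i j a b. True}"

lemma fhom_ft: "fhom tgen_par (ipar a) (ft i a)"
  unfolding ft_def by (rule fhom_fgen) simp

lemma fhom_ft_mult: "ipar a + ipar b = p \<Longrightarrow> fhom tgen_par p (ft i a * ft j b)"
  using fhom_mult[OF fhom_ft fhom_ft] by blast

instantiation tgen :: (finite, finite) presentation
begin

definition gpar_tgen :: "('a, 'b) tgen \<Rightarrow> bit" where "gpar_tgen = tgen_par"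

definition rels_tgen :: "('a, 'b) tgen falg set" where "rels_tgen = tgen_rels"

instance
proof
  fix r :: "('a, 'b) tgen falg"
  assume "r \<in> rels"
  then obtain i j a b where r: "r =
     fscale (qq ^ of_bool (i = j)) (ft i a * ft j b)
     - fscale (koszul (ipar a * ipar b) * qq powi phi a b) (ft j b * ft i a)
     - (fscale (xi * (of_bool (a < b) - of_bool (j < i))) (ft j a * ft i b)
        + fscale (koszul (ipar b) * xi * of_bool (- a < b)) (ft j (- a) * ft i (- b)))"
    unfolding rels_tgen_def tgen_rels_def by blast
  have "fhom gpar (ipar a + ipar b) r"
    unfolding r gpar_tgen_def
    by (intro fhom_diff fhom_add fhom_scale fhom_ft_mult) (cases "ipar a"; cases "ipar b"; simp)+
  then show "\<exists>p. fhom gpar p r" ..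
qed

end

(* A_{r,n} with r = CARD('r) and n = CARD('n), in the presentation by t_ia with i > 0. *)
type_synonym ('r, 'n) Aq = "('r, 'n) tgen presented"

definition tA :: "'r::finite pidx \<Rightarrow> 'n::finite idx \<Rightarrow> ('r, 'n) Aq"
  where "tA i a = pgen (TGen i a)"


section \<open>Supermodules\<close>

definition tmap :: "('a \<Rightarrow> 'c) \<Rightarrow> ('b \<Rightarrow> 'd) \<Rightarrow> 'a::qspace \<otimes> 'b::qspace \<Rightarrow> 'c::qspace \<otimes> 'd::qspace"
  where "tmap f g = tlift (\<lambda>a b. f a \<otimes> g b)"

definition tassoc :: "('a::qspace \<otimes> 'b::qspace) \<otimes> 'c::qspace \<Rightarrow> 'a \<otimes> 'b \<otimes> 'c"
  where "tassoc = tlift (\<lambda>x c. tlift (\<lambda>a b. a \<otimes> b \<otimes> c) x)"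

definition tassoc' :: "'a::qspace \<otimes> 'b::qspace \<otimes> 'c::qspace \<Rightarrow> ('a \<otimes> 'b) \<otimes> 'c"
  where "tassoc' = tlift (\<lambda>a. tlift (\<lambda>b c. (a \<otimes> b) \<otimes> c))"

definition mul :: "'a::superalgebra \<otimes> 'a \<Rightarrow> 'a"
  where "mul = tlift (*)"

definition supermodule :: "('n::finite Uq \<Rightarrow> 'm::superspace \<Rightarrow> 'm) \<Rightarrow> bool"
  where "supermodule act \<longleftrightarrow>
    qbilinear act \<and> (\<forall>x. act 1 x = x) \<and> (\<forall>u v x. act (u * v) x = act u (act v x)) \<and>
    (\<forall>p s u x. hpart p u = u \<longrightarrow> hpart s x = x \<longrightarrow> hpart (p + s) (act u x) = act u x)"

definition supermodule_hom ::
    "('n::finite Uq \<Rightarrow> 'm::superspace \<Rightarrow> 'm) \<Rightarrow> ('n Uq \<Rightarrow> 'm'::superspace \<Rightarrow> 'm') \<Rightarrow> ('m \<Rightarrow> 'm') \<Rightarrow> bool"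
  where "supermodule_hom act act' f \<longleftrightarrow>
    qlinear f \<and> (\<forall>p x. f (hpart p x) = hpart p (f x)) \<and> (\<forall>u x. f (act u x) = act' u (f x))"

(* (u1 \<otimes> u2).(a \<otimes> b) = (-1)^(|u2||a|) u1.a \<otimes> u2.b, summed over the homogeneous components of u2 and a *)
definition act2 :: "('n::finite Uq \<Rightarrow> 'm::superspace \<Rightarrow> 'm) \<Rightarrow> ('n Uq \<Rightarrow> 'm'::superspace \<Rightarrow> 'm')
    \<Rightarrow> 'n Uq \<Rightarrow> 'n Uq \<Rightarrow> 'm \<Rightarrow> 'm' \<Rightarrow> 'm \<otimes> 'm'"
  where "act2 act act' u1 u2 a b =
    (\<Sum>s\<in>{0, 1}. \<Sum>p\<in>{0, 1}. koszul (s * p) *\<^sub>q (act u1 (hpart p a) \<otimes> act' (hpart s u2) b))"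

definition tensor_act :: "('n::finite Uq \<Rightarrow> 'm::superspace \<Rightarrow> 'm) \<Rightarrow> ('n Uq \<Rightarrow> 'm'::superspace \<Rightarrow> 'm')
    \<Rightarrow> 'n Uq \<Rightarrow> 'm \<otimes> 'm' \<Rightarrow> 'm \<otimes> 'm'"
  where "tensor_act act act' u x = tlift (\<lambda>u1 u2. tlift (act2 act act' u1 u2) x) (comult u)"

definition supermodule_superalgebra :: "('n::finite Uq \<Rightarrow> 'b::superalgebra \<Rightarrow> 'b) \<Rightarrow> bool"
  where "supermodule_superalgebra act \<longleftrightarrow>
    supermodule act \<and> (\<forall>u x. act u (mul x) = mul (tensor_act act act u x)) \<and>
    (\<forall>u. act u 1 = counit u *\<^sub>q 1)"

(* The action of U_q(q_n) on A_{r,n}, determined on generators by the coefficients of E_ic \<otimes> _ \<otimes> E_ab in L^{[2]3} . T^{1[2]} = T^{1[2]} S^{13}, where on the right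
   (E_id \<otimes> t_id \<otimes> 1) (E_dc \<otimes> 1 \<otimes> E_ab) = (-1)^((|i|+|d|)(|d|+|c|)) E_ic \<otimes> t_id \<otimes> E_ab and i > 0;
   moreover |d|+|c| = |a|+|b| whenever Smat d c a b is nonzero. *)
definition coord_action :: "('n::finite Uq \<Rightarrow> ('r::finite, 'n) Aq \<Rightarrow> ('r, 'n) Aq) \<Rightarrow> bool"
  where "coord_action act \<longleftrightarrow> supermodule_superalgebra act \<and>
    (\<forall>i a b c. koszul ((ipar a + ipar b) * ipar c) *\<^sub>q act (LU a b) (tA i c)
      = (\<Sum>d\<in>UNIV. (koszul (ipar d * (ipar d + ipar c)) * Smat d c a b) *\<^sub>q tA i d))"

end

theory Submission
  imports Defs
begin

text \<open>
  After the rescaling of \<open>L\<^sub>d\<^sub>a\<close> by the sign \<open>(-1)^(|a|(|y| + |d| + 1))\<close> on elements of parity \<open>|y|\<close>,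
  all relations become those of an ordinary (non-super) RTT/RLL situation, and the prescribed value of
  \<open>\<Theta>\<close> on generators reads \<open>\<Theta>(y \<otimes> t\<^sub>i\<^sub>a) = \<Sum>\<^sub>d t\<^sub>i\<^sub>d \<otimes> L\<^sub>d\<^sub>a.y\<close>. This formula makes sense for \<open>y\<close> in any
  supermodule \<open>M\<close>, and the operators \<open>x \<otimes> y \<mapsto> \<Sum>\<^sub>d x t\<^sub>i\<^sub>d \<otimes> L\<^sub>d\<^sub>a.y\<close> satisfy the relations of the \<open>t\<^sub>i\<^sub>a\<close>
  by the RLL relations. They therefore define a right action of the coordinate superalgebra on its
  tensor product with \<open>M\<close>, and \<open>\<Theta>(y \<otimes> x) = (1 \<otimes> y).x\<close>. Multiplicativity in \<open>x\<close> is built in;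
  equivariance is again RLL, and multiplicativity in \<open>y\<close> expresses that \<open>L\<close> acts on products through
  \<open>\<Delta>(L) = L \<otimes> L\<close>.
\<close>

section \<open>Linear maps on tensor products\<close>

lemma qlinear_compose: "qlinear f \<Longrightarrow> qlinear g \<Longrightarrow> qlinear (\<lambda>x. g (f x))"
  by (simp add: qlinear_iff)

lemma qlinear_sum_fun: "(\<And>i. i \<in> I \<Longrightarrow> qlinear (f i)) \<Longrightarrow> qlinear (\<lambda>x. \<Sum>i\<in>I. f i x)"
  by (simp add: qlinear_iff sum.distrib qspace.scale_sum_right)

lemma qlinear_scale_fun: "qlinear f \<Longrightarrow> qlinear (\<lambda>x. c *\<^sub>q f x)"
  by (simp add: qlinear_iff scaleq_add_right scaleq_left_commute)

lemma qlinear_id: "qlinear id"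
  by (simp add: qlinear_iff)

lemma qlinear_tens: "qlinear (\<lambda>x. x \<otimes> b)" "qlinear (\<lambda>x. a \<otimes> x)"
  by (simp_all add: qlinear_iff tens_simps)

lemma qlinear_times: "qlinear (\<lambda>x. x * b)" "qlinear (\<lambda>x. a * x)" for a b :: "'a::superalgebra"
  by (simp_all add: qlinear_iff salg_simps)

text \<open>Maps out of iterated tensor products arise by applying \<open>tlift\<close> twice, and
  the outer application needs the inner result to depend linearly on its parameter. Induction over
  sums of pure tensors reduces this to linearity of \<open>f\<close> in \<open>c\<close>.\<close>

lemma tlift_parametric_linear:
  assumes "\<And>c. qbilinear (f c)" "\<And>a b. qlinear (\<lambda>c. f c a b)"
  shows "qlinear (\<lambda>c. tlift (f c) x)"
proof (induction x)
  case (tens a b)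
  then show ?case using assms by simp
next
  case (add x y)
  then show ?case
    by (simp add: qlinear_iff qlinear_add[OF tlift_linear[OF assms(1)]] scaleq_add_right algebra_simps)
qed

lemma tlift_parametric_bilinear:
  assumes "\<And>c. qbilinear (f c)" "\<And>a b. qlinear (\<lambda>c. f c a b)"
  shows "qbilinear (\<lambda>c x. tlift (f c) x)" "qbilinear (\<lambda>x c. tlift (f c) x)"
  using tlift_parametric_linear[of f, OF assms] tlift_linear[OF assms(1)]
  by (simp_all add: qbilinear_def)

lemma
  assumes "qlinear f" "qlinear g"
  shows tmap_tens: "tmap f g (a \<otimes> b) = f a \<otimes> g b" and tmap_linear: "qlinear (tmap f g)"
proof -
  have "qbilinear (\<lambda>a b. f a \<otimes> g b)"
    using assms by (intro qbilinearI) (simp_all add: qlinear_iff tens_simps)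
  then show "tmap f g (a \<otimes> b) = f a \<otimes> g b" "qlinear (tmap f g)"
    by (simp_all add: tmap_def tlift_linear)
qed

lemma tmap_id_left_tens: "qlinear g \<Longrightarrow> tmap id g (a \<otimes> b) = a \<otimes> g b"
  and tmap_id_right_tens: "qlinear f \<Longrightarrow> tmap f id (a \<otimes> b) = f a \<otimes> b"
  by (simp_all only: tmap_tens[OF qlinear_id] tmap_tens[OF _ qlinear_id] id_apply)

lemma
  fixes a :: "'a::qspace" and b :: "'b::qspace" and c :: "'c::qspace"
  shows tassoc_tens: "tassoc ((a \<otimes> b) \<otimes> c) = a \<otimes> (b \<otimes> c)"
    and tassoc_linear: "qlinear (tassoc :: ('a \<otimes> 'b) \<otimes> 'c \<Rightarrow> _)"
    and tassoc'_tens: "tassoc' (a \<otimes> (b \<otimes> c)) = (a \<otimes> b) \<otimes> c"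
    and tassoc'_linear: "qlinear (tassoc' :: 'a \<otimes> 'b \<otimes> 'c \<Rightarrow> _)"
proof -
  have 1: "qbilinear (\<lambda>(a::'a) (b::'b). a \<otimes> b \<otimes> (c::'c))" for c
    by (intro qbilinearI) (simp_all add: tens_simps)
  have 2: "qlinear (\<lambda>c. (a::'a) \<otimes> (b::'b) \<otimes> (c::'c))" for a b
    by (simp add: qlinear_iff tens_simps)
  from tlift_parametric_bilinear(2)[of "\<lambda>c a b. a \<otimes> b \<otimes> c", OF 1 2]
  show "tassoc ((a \<otimes> b) \<otimes> c) = a \<otimes> (b \<otimes> c)" "qlinear (tassoc :: ('a \<otimes> 'b) \<otimes> 'c \<Rightarrow> _)"
    unfolding tassoc_def by (simp_all add: tlift_linear 1)
  have 1: "qbilinear (\<lambda>(b::'b) (c::'c). ((a::'a) \<otimes> b) \<otimes> c)" for a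
    by (intro qbilinearI) (simp_all add: tens_simps)
  have 2: "qlinear (\<lambda>a. ((a::'a) \<otimes> (b::'b)) \<otimes> (c::'c))" for b c
    by (simp add: qlinear_iff tens_simps)
  from tlift_parametric_bilinear(1)[of "\<lambda>a b c. (a \<otimes> b) \<otimes> c", OF 1 2]
  show "tassoc' (a \<otimes> (b \<otimes> c)) = (a \<otimes> b) \<otimes> c" "qlinear (tassoc' :: 'a \<otimes> 'b \<otimes> 'c \<Rightarrow> _)"
    unfolding tassoc'_def by (simp_all add: tlift_linear 1)
qed

lemma
  fixes a b :: "'a::superalgebra"
  shows mul_tens: "mul (a \<otimes> b) = a * b" and mul_linear: "qlinear (mul :: 'a \<otimes> 'a \<Rightarrow> 'a)"
proof -
  have "qbilinear ((*) :: 'a \<Rightarrow> 'a \<Rightarrow> 'a)" by (intro qbilinearI) (simp_all add: salg_simps)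
  then show "mul (a \<otimes> b) = a * b" "qlinear (mul :: 'a \<otimes> 'a \<Rightarrow> 'a)"
    unfolding mul_def by (simp_all add: tlift_linear)
qed

text \<open>Koszul signs have a definite value only on homogeneous elements; this rule lets additive
  statements be checked there, since every element is the sum of its two components.\<close>

lemma superspace_induct [case_names hom add]:
  fixes x :: "'a::superspace"
  assumes "\<And>p x. hpart p x = x \<Longrightarrow> P x" "\<And>x y. P x \<Longrightarrow> P y \<Longrightarrow> P (x + y)"
  shows "P x"
proof -
  have "P (hpart 0 x + hpart 1 x)"
    by (intro assms(2) assms(1)[of 0] assms(1)[of 1]) (simp_all add: hpart_hpart)
  then show ?thesis by (simp add: hpart_sum)
qed

lemma mul_even: "mul (hpart p x) = hpart p (mul x)"
proof (induction x rule: tensor_induct_hom)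
  case (tens a b r s)
  then show ?case
    using hpart_hom[OF hpart_mult[OF tens], of p] by (simp add: hpart_tens_hom mul_tens qlinear_0[OF mul_linear])
qed (simp add: hpart_add qlinear_add[OF mul_linear])

section \<open>Tensor products of supermodules\<close>

lemma supermoduleD:
  assumes "supermodule act"
  shows "qbilinear act" "act 1 x = x" "act (u * v) x = act u (act v x)"
    and "hpart p u = u \<Longrightarrow> hpart s x = x \<Longrightarrow> hpart (p + s) (act u x) = act u x"
  using assms by (simp_all add: supermodule_def)

lemma qbilinear_linear:
  assumes "qbilinear f" shows "qlinear (f a)" "qlinear (\<lambda>a. f a b)"
  using assms by (auto simp: qbilinear_def)

context
  fixes act :: "'n::finite Uq \<Rightarrow> 'm::superspace \<Rightarrow> 'm" and act' :: "'n Uq \<Rightarrow> 'm'::superspace \<Rightarrow> 'm'"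
  assumes act: "supermodule act" and act': "supermodule act'"
begin

lemma act2_bilinear: "qbilinear (act2 act act' u1 u2)"
  and act2_bilinear': "qbilinear (\<lambda>u1 u2. act2 act act' u1 u2 a b)"
  unfolding act2_def
  by (intro qbilinear_sum qbilinear_scale qbilinearI;
      simp add: hpart_add hpart_scaleq tens_simps qbilinearD[OF supermoduleD(1)[OF act]] qbilinearD[OF supermoduleD(1)[OF act']])+

lemma act2_hom:
  assumes "hpart s u2 = u2" "hpart p a = a"
  shows "act2 act act' u1 u2 a b = koszul (s * p) *\<^sub>q (act u1 a \<otimes> act' u2 b)"
  using qlinear_0[OF qbilinear_linear(1)[OF supermoduleD(1)[OF act]]]
    qlinear_0[OF qbilinear_linear(2)[OF supermoduleD(1)[OF act']]]
  by (cases s; cases p)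
    (simp_all add: act2_def hpart_hom[OF assms(1)] hpart_hom[OF assms(2)] scaleq_one)

lemma tlift_act2_bilinear: "qbilinear (\<lambda>u1 u2. tlift (act2 act act' u1 u2) x)"
proof (induction x)
  case (tens a b)
  then show ?case by (simp add: act2_bilinear act2_bilinear')
next
  case (add x y)
  then show ?case
    by (simp add: qlinear_add[OF tlift_linear[OF act2_bilinear]] qbilinear_def qlinear_iff scaleq_add_right)
qed

lemma tensor_act_bilinear: "qbilinear (tensor_act act act')"
proof -
  have "qlinear (\<lambda>x. tlift (\<lambda>u1 u2. tlift (act2 act act' u1 u2) x) w)" for w
    by (rule tlift_parametric_linear[OF tlift_act2_bilinear tlift_linear[OF act2_bilinear]])
  moreover have "qlinear comult"
    by (simp add: qlinear_iff comult_hom)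
  from qlinear_compose[OF this tlift_linear[OF tlift_act2_bilinear]]
  have "qlinear (\<lambda>u. tlift (\<lambda>u1 u2. tlift (act2 act act' u1 u2) x) (comult u))" for x .
  ultimately show ?thesis
    by (simp add: qbilinear_def tensor_act_def[abs_def])
qed

lemma tensor_act_1: "tensor_act act act' 1 x = x"
proof (induction x rule: tensor_induct_hom)
  case (tens a b p s)
  show ?case
    unfolding tensor_act_def comult_hom one_tensor_def tlift_tens[OF tlift_act2_bilinear]
      tlift_tens[OF act2_bilinear] tlift_tens[OF act2_bilinear'] act2_hom[OF hpart_one tens(1)] supermoduleD(2)[OF act] supermoduleD(2)[OF act']
    by (simp add: scaleq_one)
qed (simp add: qbilinearD[OF tensor_act_bilinear])

text \<open>As \<open>comult\<close> is multiplicative, it suffices to compare one action of a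
  product of tensors with two successive actions, on homogeneous pure tensors.\<close>

lemma tensor_act_mult: "tensor_act act act' (u * v) x = tensor_act act act' u (tensor_act act act' v x)"
proof -
  let ?T = "\<lambda>w x. tlift (\<lambda>u1 u2. tlift (act2 act act' u1 u2) x) w"
  have Tx: "qlinear (?T w)" for w
    by (rule tlift_parametric_linear[OF tlift_act2_bilinear tlift_linear[OF act2_bilinear]])
  note Tw = tlift_linear[OF tlift_act2_bilinear]
  note lin = qlinear_add[OF Tx] qlinear_add[OF Tw] qlinear_scale[OF Tx] qlinear_scale[OF Tw]
  have "?T (w * z) x = ?T w (?T z x)" for w z
  proof (induction w rule: tensor_induct_hom)
    case (tens u1 u2 p1 p2)
    note u = tens
    show ?case
    proof (induction z rule: tensor_induct_hom)
      case (tens v1 v2 q1 q2)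
      note v = tens
      show ?case
      proof (induction x rule: tensor_induct_hom)
        case (tens a b r s)
        have h: "hpart (p2 + q2) (u2 * v2) = u2 * v2" "hpart (q1 + r) (act v1 a) = act v1 a"
          using u v tens by (blast intro: hpart_mult supermoduleD(4)[OF act])+
        \<comment> \<open>Both sides record the same interchanges: \<open>u2\<close> past
          \<open>v1\<close>, \<open>u2\<close> past \<open>a\<close> and \<open>v2\<close> past
          \<open>a\<close>.\<close>
        have s: "koszul (p2 * q1) * koszul ((p2 + q2) * r) = koszul (q2 * r) * koszul (p2 * (q1 + r))"
          by (cases p2; cases q1; cases q2; cases r) simp_all
        have "?T ((u1 \<otimes> u2) * (v1 \<otimes> v2)) (a \<otimes> b)
            = koszul (p2 * q1) *\<^sub>q koszul ((p2 + q2) * r) *\<^sub>q (act (u1 * v1) a \<otimes> act' (u2 * v2) b)"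
          by (simp only: times_tens_hom[OF u(2) v(1)] lin tlift_tens[OF tlift_act2_bilinear]
              tlift_tens[OF act2_bilinear] tlift_tens[OF act2_bilinear']
              qlinear_scale[OF tlift_linear[OF act2_bilinear']] act2_hom[OF h(1) tens(1)])
        moreover have "?T (v1 \<otimes> v2) (a \<otimes> b) = koszul (q2 * r) *\<^sub>q (act v1 a \<otimes> act' v2 b)"
          by (simp only: tlift_tens[OF tlift_act2_bilinear] tlift_tens[OF act2_bilinear] tlift_tens[OF act2_bilinear'] act2_hom[OF v(2) tens(1)])
        moreover have "?T (u1 \<otimes> u2) (act v1 a \<otimes> act' v2 b)
            = koszul (p2 * (q1 + r)) *\<^sub>q (act u1 (act v1 a) \<otimes> act' u2 (act' v2 b))"
          by (simp only: tlift_tens[OF tlift_act2_bilinear] tlift_tens[OF act2_bilinear] tlift_tens[OF act2_bilinear'] act2_hom[OF u(2) h(2)])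
        ultimately show ?case
          by (simp only: lin(3) scaleq_scaleq s supermoduleD(3)[OF act] supermoduleD(3)[OF act'])
      qed (simp only: lin)
    qed (simp only: distrib_left lin)
  qed (simp only: distrib_right lin)
  then show ?thesis by (simp add: tensor_act_def comult_hom)
qed

lemma tensor_act_LU:
  assumes "hpart p a = a"
  shows "tensor_act act act' (LU i j) (a \<otimes> b) =
    (\<Sum>k\<in>UNIV. koszul ((ipar i + ipar k) * (ipar k + ipar j) + (ipar k + ipar j) * p) *\<^sub>q
      (act (LU i k) a \<otimes> act' (LU k j) b))"
  unfolding tensor_act_def comult_LU comult_gen_def
  by (simp only: qlinear_sum[OF tlift_linear[OF tlift_act2_bilinear]] qlinear_scale[OF tlift_linear[OF tlift_act2_bilinear]]
     tlift_tens[OF tlift_act2_bilinear] tlift_tens[OF act2_bilinear] tlift_tens[OF act2_bilinear']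
     qlinear_sum[OF tlift_linear[OF act2_bilinear']] qlinear_scale[OF tlift_linear[OF act2_bilinear']] act2_hom[OF hpart_LU assms] scaleq_scaleq koszul_add)

end

section \<open>Sign-free form of the relations\<close>

text \<open>The sign absorbs what is left of the Koszul signs after the rescaling in
  \<open>Lhat\<close>. The resulting entries are the coefficients in the prescribed value of Theta
  on generators, as \<open>Shat_sum\<close> makes explicit.\<close>

definition Shat :: "'n::finite idx \<Rightarrow> 'n idx \<Rightarrow> 'n idx \<Rightarrow> 'n idx \<Rightarrow> cq"
  where "Shat a b c d = koszul (ipar a * ipar d + ipar a + ipar b) * Smat a b c d"

(* The sign is chosen so that Delta, products, the RLL relations and the action on the t_ia
   (Lhat_tens, Lhat_mult, Lhat_RLL, Lhat_tA) involve Shat only and no Koszul signs. *)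
definition Lhat :: "('n::finite Uq \<Rightarrow> 'm::superspace \<Rightarrow> 'm) \<Rightarrow> 'n idx \<Rightarrow> 'n idx \<Rightarrow> 'm \<Rightarrow> 'm"
  where "Lhat act a b x = (\<Sum>p\<in>{0, 1}. koszul (ipar b * (p + ipar a + 1)) *\<^sub>q act (LU a b) (hpart p x))"

lemma Lhat_linear: "qbilinear act \<Longrightarrow> qlinear (Lhat act a b)"
  unfolding Lhat_def
  by (intro qlinear_sum_fun qlinear_scale_fun qlinear_compose[OF hpart_linear] qbilinear_linear(1))

lemma Lhat_hom:
  assumes "qbilinear act" "hpart p x = x"
  shows "Lhat act a b x = koszul (ipar b * (p + ipar a + 1)) *\<^sub>q act (LU a b) x"
  using qlinear_0[OF qbilinear_linear(1)[OF assms(1)]]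
  by (cases p) (simp_all add: Lhat_def hpart_hom[OF assms(2)])

text \<open>The signs in \<open>Lhat\<close> depend only on indices and on the parity of the
  argument, and \<open>f\<close> preserves parity.\<close>

lemma Lhat_equivariant:
  assumes "qbilinear act" "qbilinear act'" "qlinear f"
    and "\<And>p x. f (hpart p x) = hpart p (f x)" "\<And>x. f (act (LU a b) x) = act' (LU a b) (f x)"
  shows "f (Lhat act a b x) = Lhat act' a b (f x)"
  by (simp only: Lhat_def qlinear_sum[OF assms(3)] qlinear_scale[OF assms(3)] assms(4,5))

text \<open>Each sign squares to one, so it can be cancelled on homogeneous elements. Through this
  lemma sign-free computations yield equivariance under the actual generators.\<close>

lemma LU_equivariant:
  assumes "qbilinear act" "qbilinear act'" "qlinear f"
    and "\<And>p x. f (hpart p x) = hpart p (f x)" "\<And>x. f (Lhat act a b x) = Lhat act' a b (f x)"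
  shows "f (act (LU a b) x) = act' (LU a b) (f x)"
proof (induction x rule: superspace_induct)
  case (hom p x)
  let ?k = "koszul (ipar b * (p + ipar a + 1))"
  have "hpart p (f x) = f x" using hom assms(4)[of p x] by simp
  from assms(5)[of x, unfolded Lhat_hom[OF assms(1) hom] Lhat_hom[OF assms(2) this] qlinear_scale[OF assms(3)]]
  have "?k *\<^sub>q ?k *\<^sub>q f (act (LU a b) x) = ?k *\<^sub>q ?k *\<^sub>q act' (LU a b) (f x)" by (rule arg_cong)
  moreover have "?k * ?k = 1" by (simp add: koszul_def)
  ultimately show ?case by (simp add: scaleq_scaleq scaleq_one del: add_bit_eq_xor mult_bit_eq_and)
qed (simp add: qbilinearD[OF assms(1)] qbilinearD[OF assms(2)] qlinear_add[OF assms(3)])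

lemma Lhat_tens:
  assumes act: "supermodule act" and act': "supermodule act'"
  shows "Lhat (tensor_act act act') a b (x \<otimes> y) = (\<Sum>c\<in>UNIV. Lhat act a c x \<otimes> Lhat act' c b y)"
proof (induction x rule: superspace_induct)
  case (hom p x)
  note x = this
  show ?case
  proof (induction y rule: superspace_induct)
    case (hom s y)
    have "hpart (p + s) (x \<otimes> y) = x \<otimes> y" using x hom by (simp only: hpart_tens_hom if_True refl)
    note h = Lhat_hom[OF tensor_act_bilinear[OF act act'] this]
      Lhat_hom[OF supermoduleD(1)[OF act] x] Lhat_hom[OF supermoduleD(1)[OF act'] hom]
    \<comment> \<open>On the left stand the sign of \<open>Lhat\<close> on the tensor, the sign in
      the coproduct and the sign of moving \<open>LU c b\<close> past \<open>x\<close>; on the right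
      stand the signs of \<open>Lhat\<close> on the two factors.\<close>
    have s: "koszul (b * (p + s + a + 1)) * koszul ((a + c) * (c + b) + (c + b) * p) =
        koszul (b * (s + c + 1)) * koszul (c * (p + a + 1))" for a b c
      by (cases a; cases b; cases c; cases p; cases s) simp_all
    show ?case
      by (simp only: h tensor_act_LU[OF act act' x] qspace.scale_sum_right tens_simps scaleq_scaleq s)
  qed (simp only: tens_simps qlinear_add[OF Lhat_linear[OF tensor_act_bilinear[OF act act']]]
     qlinear_add[OF Lhat_linear[OF supermoduleD(1)[OF act']]] sum.distrib)
qed (simp only: tens_simps qlinear_add[OF Lhat_linear[OF tensor_act_bilinear[OF act act']]]
     qlinear_add[OF Lhat_linear[OF supermoduleD(1)[OF act]]] sum.distrib)

text \<open>In a supermodule superalgebra multiplication is an even equivariant map, so the rule for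
  pure tensors passes to products.\<close>

lemma Lhat_mult:
  assumes "supermodule_superalgebra act"
  shows "Lhat act a b (x * y) = (\<Sum>c\<in>UNIV. Lhat act a c x * Lhat act c b y)"
proof -
  have act: "supermodule act" and m: "mul (tensor_act act act u z) = act u (mul z)" for u z
    using assms by (simp_all add: supermodule_superalgebra_def)
  have "Lhat act a b (mul (x \<otimes> y)) = mul (Lhat (tensor_act act act) a b (x \<otimes> y))"
    by (rule Lhat_equivariant[where f = mul, OF tensor_act_bilinear[OF act act] supermoduleD(1)[OF act]
          mul_linear mul_even m, symmetric])
  then show ?thesis by (simp add: Lhat_tens[OF act act] qlinear_sum[OF mul_linear] mul_tens)
qed

lemma Lhat_1:
  assumes "supermodule_superalgebra act"
  shows "Lhat act a b 1 = of_bool (a = b) *\<^sub>q 1"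
proof -
  have act: "supermodule act" and m: "act u 1 = counit u *\<^sub>q 1" for u
    using assms by (simp_all add: supermodule_superalgebra_def)
  \<comment> \<open>Off the diagonal \<open>counit\<close> vanishes; on it the sign is one, because
    a bit times its successor is zero.\<close>
  have "koszul (b * (0 + b + 1)) = 1" for b by (cases b) simp_all
  then show ?thesis
    by (cases "a = b") (simp_all only: Lhat_hom[OF supermoduleD(1)[OF act] hpart_one] m counit_LU scaleq_scaleq
      of_bool_eq mult_1_right mult_zero_right simp_thms)
qed

lemma act_sum:
  assumes "qbilinear act" shows "act (\<Sum>i\<in>I. u i) x = (\<Sum>i\<in>I. act (u i) x)"
  by (rule qlinear_sum[OF qbilinear_linear(2)[OF assms]])

text \<open>This is \<open>RLL\<close> applied to a homogeneous \<open>x\<close>: after the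
  rescaling all summands on both sides carry the same sign \<open>?k\<close>, which depends only on
  the free indices and the parity of \<open>x\<close> and therefore factors out.\<close>

lemma Lhat_RLL:
  assumes act: "supermodule act"
  shows "(\<Sum>d\<in>UNIV. \<Sum>e\<in>UNIV. Shat f d c e *\<^sub>q Lhat act e b (Lhat act d a x))
    = (\<Sum>d\<in>UNIV. \<Sum>e\<in>UNIV. Shat d a e b *\<^sub>q Lhat act f d (Lhat act c e x))"
proof (induction x rule: superspace_induct)
  case (hom p x)
  note b = supermoduleD(1)[OF act]
  have LL: "Lhat act i j (Lhat act k l x) =
      (koszul (ipar j * (ipar k + ipar l + p + ipar i + 1)) * koszul (ipar l * (p + ipar k + 1))) *\<^sub>q act (LU i j * LU k l) x" for i j k l
  proof -
    have "hpart (ipar k + ipar l + p) (act (LU k l) x) = act (LU k l) x"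
      by (rule supermoduleD(4)[OF act hpart_LU hom])
    from Lhat_hom[OF b this] show ?thesis
      by (simp only: Lhat_hom[OF b hom] qlinear_scale[OF Lhat_linear[OF b]] supermoduleD(3)[OF act] scaleq_scaleq mult.commute)
  qed
  let ?k = "koszul (ipar a * p + ipar a + ipar b * p + ipar b * ipar a + ipar b + ipar f * ipar a
     + ipar f * ipar b + ipar b * ipar c + ipar c * ipar f)"
  \<comment> \<open>The parity hypothesis is \<open>Smat_even\<close> for a nonzero entry of
    \<open>Smat\<close>; summands with a zero entry are treated separately below.\<close>
  have s1: "koszul (f * e + f + d) * (koszul (b * (d + a + p + e + 1)) * koszul (a * (p + d + 1)))
     = koszul (a * p + a + b * p + b * a + b + f * a + f * b + b * c + c * f) * koszul ((c + e) * (d + a))"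
    if "f + d + c + e = 0" for a b c d e f :: bit
    using that by (cases a; cases b; cases c; cases d; cases e; cases f; cases p) simp_all
  have s2: "koszul (d * b + d + a) * (koszul (d * (c + e + p + f + 1)) * koszul (e * (p + c + 1)))
     = koszul (a * p + a + b * p + b * a + b + f * a + f * b + b * c + c * f) * koszul ((c + e) * (f + a))"
    if "d + a + e + b = 0" for a b c d e f :: bit
    using that by (cases a; cases b; cases c; cases d; cases e; cases f; cases p) simp_all
  have "Shat f d c e *\<^sub>q Lhat act e b (Lhat act d a x)
     = ?k *\<^sub>q act ((koszul ((ipar c + ipar e) * (ipar d + ipar a)) * Smat f d c e) *\<^sub>q (LU e b * LU d a)) x" for d e
  proof (cases "Smat f d c e = 0")
    case False
    then show ?thesis
      unfolding LL Shat_def qlinear_scale[OF qbilinear_linear(2)[OF b]] scaleq_scaleq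
      using arg_cong[OF s1[OF Smat_even[OF False], of "ipar b" "ipar a"], of "\<lambda>z. z * Smat f d c e"]
      by (simp only: mult_ac)
  qed (simp only: Shat_def mult_zero_right qspace.scale_zero_left qspace.scale_zero_right
      qlinear_0[OF qbilinear_linear(2)[OF b]])
  moreover have "Shat d a e b *\<^sub>q Lhat act f d (Lhat act c e x)
     = ?k *\<^sub>q act ((koszul ((ipar c + ipar e) * (ipar f + ipar a)) * Smat d a e b) *\<^sub>q (LU f d * LU c e)) x" for d e
  proof (cases "Smat d a e b = 0")
    case False
    then show ?thesis
      unfolding LL Shat_def qlinear_scale[OF qbilinear_linear(2)[OF b]] scaleq_scaleq
      using arg_cong[OF s2[OF Smat_even[OF False], of "ipar c" "ipar f"], of "\<lambda>z. z * Smat d a e b"]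
      by (simp only: mult_ac)
  qed (simp only: Shat_def mult_zero_right qspace.scale_zero_left qspace.scale_zero_right
      qlinear_0[OF qbilinear_linear(2)[OF b]])
  ultimately show ?case
    by (simp only: qspace.scale_sum_right[symmetric] act_sum[OF b, symmetric] RLL)
next
  case (add x y)
  show ?case
    unfolding qlinear_add[OF Lhat_linear[OF supermoduleD(1)[OF act]]] scaleq_add_right sum.distrib add ..
qed

text \<open>For fixed column indices \<open>a\<close> and \<open>b\<close> there are three kinds of
  contributions, the diagonal one and two with factor \<open>xi\<close>. The lemma translates
  between sums over all indices and the three-term formulas in the relations and in the value of
  Theta.\<close>

lemma Shat_sum:
  fixes F :: "'n::finite idx \<Rightarrow> 'n idx \<Rightarrow> 'a::qspace"
  shows "(\<Sum>c\<in>UNIV. \<Sum>e\<in>UNIV. Shat e a c b *\<^sub>q F c e) =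
    (koszul (ipar a * ipar b) * qq powi phi a b) *\<^sub>q F b a
    + (of_bool (a < b) * xi) *\<^sub>q F a b + (of_bool (- a < b) * koszul (ipar b) * xi) *\<^sub>q F (- a) (- b)"
proof -
  have S: "Shat e a c b *\<^sub>q F c e =
      (if c = b then if e = a then (koszul (ipar a * ipar b) * qq powi phi a b) *\<^sub>q F b a else 0 else 0)
      + (if c = a then if e = b then (of_bool (a < b) * xi) *\<^sub>q F a b else 0 else 0)
      + (if c = - a then if e = - b then (of_bool (- a < b) * koszul (ipar b) * xi) *\<^sub>q F (- a) (- b) else 0 else 0)" for c e
  proof -
    have s: "koszul (p * s + p + p) = koszul (p * s)" "koszul (s * s + s + p) * koszul p = 1"
      "koszul ((s + 1) * s + (s + 1) + p) * koszul (p + 1) = koszul s" for p s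
      by (cases p; cases s; simp)+
    have 1: "koszul (ipar e * ipar b + ipar e + ipar a) * (if e = a \<and> c = b then qq powi phi e c else 0)
       = (if c = b then if e = a then koszul (ipar a * ipar b) * qq powi phi a b else 0 else 0)"
      by (simp only: s(1) if_distrib[where f = "(*) _"] mult_zero_right cong: if_cong) auto
    have 2: "koszul (ipar e * ipar b + ipar e + ipar a) *
        (if c < b then xi * koszul (ipar c) * of_bool (e = b \<and> a = c) else 0)
       = (if c = a then if e = b then of_bool (a < b) * xi else 0 else 0)"
    proof (cases "c = a \<and> e = b")
      case True
      then show ?thesis using s(2)[of "ipar b" "ipar a"]
        by (simp add: mult.left_commute del: add_bit_eq_xor mult_bit_eq_and)
    qed auto
    have 3: "koszul (ipar e * ipar b + ipar e + ipar a) *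
        (if c < b then xi * koszul (ipar c) * of_bool (e = - b \<and> a = - c) else 0)
       = (if c = - a then if e = - b then of_bool (- a < b) * koszul (ipar b) * xi else 0 else 0)"
    proof (cases "c = - a \<and> e = - b")
      case True
      then show ?thesis using s(3)[of "ipar b" "ipar a"]
        by (simp add: mult.left_commute mult.commute del: add_bit_eq_xor mult_bit_eq_and)
    qed auto
    have "Smat e a c b = (if e = a \<and> c = b then qq powi phi e c else 0)
       + (if c < b then xi * koszul (ipar c) * of_bool (e = b \<and> a = c) else 0)
       + (if c < b then xi * koszul (ipar c) * of_bool (e = - b \<and> a = - c) else 0)"
      by (simp add: Smat_def distrib_left)
    then show ?thesis
      unfolding Shat_def by (simp only: distrib_left 1 2 3) (simp add: scaleq_add_left)
  qed
  have D: "(\<Sum>c\<in>UNIV. \<Sum>e\<in>UNIV. if c = x then if e = y then v else 0 else 0) = v"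
    for x y :: "'n idx" and v :: 'a
  proof -
    have "(\<Sum>e\<in>UNIV. if c = x then if e = y then v else 0 else 0) = (if c = x then v else 0)" for c
      by simp
    then show ?thesis by simp
  qed
  show ?thesis unfolding S sum.distrib D by (rule refl)
qed

section \<open>Generators and sign-free relations of the coordinate superalgebra\<close>

lemma tA_abs: "tA i a = abs_presented (ft i a)"
  by (simp add: tA_def ft_def pgen.abs_eq)

lemma hpart_tA: "hpart (ipar a) (tA i a) = tA i a"
  by (simp only: tA_abs hpart_presented.abs_eq gpar_tgen_def fpart_fhom[OF fhom_ft] if_True refl)

lemma Aq_induct [case_names one scale mult add]:
  assumes "P 1" "\<And>c x. P x \<Longrightarrow> P (c *\<^sub>q x)" "\<And>i a x. P x \<Longrightarrow> P (tA i a * x)"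
    "\<And>x y. P x \<Longrightarrow> P y \<Longrightarrow> P (x + y)"
  shows "P (x :: ('r::finite, 'n::finite) Aq)"
proof (induction x)
  case (mult g x)
  then show ?case using assms(3)[of x] by (cases g) (simp add: tA_def)
qed (use assms in auto)

text \<open>The coefficient \<open>v - u\<close> is split and its \<open>u\<close> part moved to the
  other side. With \<open>u\<close> the indicator of \<open>j < i\<close>, the right-hand side
  becomes exactly the sum evaluated in \<open>Shat_sum\<close>.\<close>

lemma collect_relation:
  fixes X Y B D :: "'a::qspace"
  shows "X + (xi * u) *\<^sub>q B = Y + (v * xi) *\<^sub>q B + (w * k * xi) *\<^sub>q D
    \<longleftrightarrow> X - Y - ((xi * (v - u)) *\<^sub>q B + (k * xi * w) *\<^sub>q D) = 0"
proof -
  have 1: "(xi * (v - u)) *\<^sub>q B = (v * xi) *\<^sub>q B - (xi * u) *\<^sub>q B"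
    by (simp only: right_diff_distrib qspace.scale_left_diff_distrib mult.commute)
  have 2: "(k * xi * w) *\<^sub>q D = (w * k * xi) *\<^sub>q D"
    by (simp only: mult_ac)
  have "X + P = Y + Q + R \<longleftrightarrow> X - Y - ((Q - P) + R) = 0" for P Q R :: 'a
    by (metis (no_types, opaque_lifting) add.assoc add.commute diff_add_eq diff_diff_eq2 diff_diff_eq diff_eq_eq right_minus_eq)
  then show ?thesis unfolding 1 2 .
qed

text \<open>The relators are checked in RTT form. The left-hand side is S acting on the positive row
  indices \<open>i\<close> and \<open>j\<close>; its entries
  \<open>E_{-j,-i} \<otimes> E_{ij}\<close> never meet two positive rows.\<close>

lemma respecting_tgenI:
  fixes f :: "('r::finite, 'n::finite) tgen \<Rightarrow> 'b::{qspace, ring, monoid_mult}"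
  assumes q: "q_algebra (scaleq :: cq \<Rightarrow> 'b \<Rightarrow> 'b)"
    and rel: "\<And>i j a b. qq ^ of_bool (i = j) *\<^sub>q (f (TGen i a) * f (TGen j b))
        + (xi * of_bool (j < i)) *\<^sub>q (f (TGen j a) * f (TGen i b))
      = (\<Sum>c\<in>UNIV. \<Sum>e\<in>UNIV. Shat e a c b *\<^sub>q (f (TGen j c) * f (TGen i e)))"
  shows "respecting scaleq f"
proof -
  interpret q_algebra "scaleq :: cq \<Rightarrow> 'b \<Rightarrow> 'b" by (rule q)
  show ?thesis
  proof
    fix r :: "('r, 'n) tgen falg"
    assume "r \<in> rels"
    then obtain i j a b where r: "r =
       fscale (qq ^ of_bool (i = j)) (ft i a * ft j b)
       - fscale (koszul (ipar a * ipar b) * qq powi phi a b) (ft j b * ft i a)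
       - (fscale (xi * (of_bool (a < b) - of_bool (j < i))) (ft j a * ft i b)
          + fscale (koszul (ipar b) * xi * of_bool (- a < b)) (ft j (- a) * ft i (- b)))"
      unfolding rels_tgen_def tgen_rels_def by blast
    have e: "fa_eval scaleq f (ft i a) = f (TGen i a)" for i a
      by (simp add: ft_def fa_eval_gen)
    show "fa_eval scaleq f r = 0"
      using rel[of i j a b]
      unfolding r Shat_sum fa_eval_diff fa_eval_add fa_eval_scale fa_eval_mult e
      unfolding collect_relation .
  qed
qed

lemma tA_relation:
  "qq ^ of_bool (i = j) *\<^sub>q (tA i a * tA j b) + (xi * of_bool (j < i)) *\<^sub>q (tA j a * tA i b)
    = (\<Sum>c\<in>UNIV. \<Sum>e\<in>UNIV. Shat e a c b *\<^sub>q (tA j c * tA i e))"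
proof -
  have "fscale (qq ^ of_bool (i = j)) (ft i a * ft j b)
       - fscale (koszul (ipar a * ipar b) * qq powi phi a b) (ft j b * ft i a)
       - (fscale (xi * (of_bool (a < b) - of_bool (j < i))) (ft j a * ft i b)
          + fscale (koszul (ipar b) * xi * of_bool (- a < b)) (ft j (- a) * ft i (- b))) \<in> rels"
    unfolding rels_tgen_def tgen_rels_def by blast
  note r = abs_presented_rels[OF this]
  show ?thesis
    using r[folded minus_presented.abs_eq plus_presented.abs_eq scaleq_presented.abs_eq times_presented.abs_eq tA_abs]
    unfolding Shat_sum
    unfolding collect_relation .
qed

section \<open>The braiding of a supermodule with a coordinate superalgebra\<close>

(* Endomorphisms multiplied as (f * g) x = g (f x): algebra homomorphisms into this type are right
   module structures. *)
typedef (overloaded) 'm opend = "{f :: 'm::qspace \<Rightarrow> 'm. qlinear f}"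
  morphisms opend_app Abs_opend
  by (rule exI[of _ id]) (simp add: qlinear_id)

setup_lifting type_definition_opend

instantiation opend :: (qspace) "{qspace, ring, monoid_mult}"
begin

lift_definition zero_opend :: "'a opend" is "\<lambda>x. 0" by (simp add: qlinear_iff)
lift_definition one_opend :: "'a opend" is "\<lambda>x. x" by (simp add: qlinear_iff)
lift_definition plus_opend :: "'a opend \<Rightarrow> 'a opend \<Rightarrow> 'a opend" is "\<lambda>f g x. f x + g x"
  by (simp add: qlinear_iff scaleq_add_right algebra_simps)
lift_definition minus_opend :: "'a opend \<Rightarrow> 'a opend \<Rightarrow> 'a opend" is "\<lambda>f g x. f x - g x"
  by (simp add: qlinear_iff qspace.scale_right_diff_distrib algebra_simps)
lift_definition uminus_opend :: "'a opend \<Rightarrow> 'a opend" is "\<lambda>f x. - f x"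
  by (simp add: qlinear_iff algebra_simps)
lift_definition times_opend :: "'a opend \<Rightarrow> 'a opend \<Rightarrow> 'a opend" is "\<lambda>f g x. g (f x)"
  by (rule qlinear_compose)
lift_definition scaleq_opend :: "cq \<Rightarrow> 'a opend \<Rightarrow> 'a opend" is "\<lambda>c f x. c *\<^sub>q f x"
  by (rule qlinear_scale_fun)

instance
proof
  fix a b c :: "'a opend" and k l :: cq
  show "a + b + c = a + (b + c)" by transfer (simp add: add.assoc)
  show "a + b = b + a" by transfer (simp add: add.commute)
  show "0 + a = a" by transfer simp
  show "- a + a = 0" by transfer simp
  show "a - b = a + - b" by transfer simp
  show "k *\<^sub>q (a + b) = k *\<^sub>q a + k *\<^sub>q b" by transfer (simp add: scaleq_add_right)
  show "(k + l) *\<^sub>q a = k *\<^sub>q a + l *\<^sub>q a" by transfer (simp add: scaleq_add_left)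
  show "k *\<^sub>q l *\<^sub>q a = (k * l) *\<^sub>q a" by transfer (simp add: scaleq_scaleq)
  show "1 *\<^sub>q a = a" by transfer (simp add: scaleq_one)
  show "a * b * c = a * (b * c)" by transfer simp
  show "1 * a = a" "a * 1 = a" by (transfer, simp)+
  show "(a + b) * c = a * c + b * c" by transfer (simp add: qlinear_add)
  show "a * (b + c) = a * b + a * c" by transfer simp
qed

end

text \<open>\<open>opend\<close> carries no grading, so the corresponding fact for superalgebras
  does not cover it; evaluating relators requires only this much structure.\<close>

lemma q_algebra_opend: "q_algebra (scaleq :: cq \<Rightarrow> 'm::qspace opend \<Rightarrow> 'm opend)"
proof
  show "(c *\<^sub>q x) * y = c *\<^sub>q (x * y)" for c and x y :: "'m opend"
    by transfer (auto simp: qlinear_scale)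
  show "x * (c *\<^sub>q y) = c *\<^sub>q (x * y)" for c and x y :: "'m opend"
    by transfer auto
qed

definition braid_gen :: "('n::finite Uq \<Rightarrow> 'm::superspace \<Rightarrow> 'm) \<Rightarrow> 'r::finite pidx \<Rightarrow> 'n idx
    \<Rightarrow> ('r, 'n) Aq \<otimes> 'm \<Rightarrow> ('r, 'n) Aq \<otimes> 'm"
  where "braid_gen act i a = tlift (\<lambda>x y. \<Sum>d\<in>UNIV. (x * tA i d) \<otimes> Lhat act d a y)"

text \<open>The definition is meaningful once \<open>braid_respecting\<close> shows that the
  generator operators satisfy the relations. As products in \<open>opend\<close> compose from left
  to right, \<open>x * y\<close> acts by \<open>x\<close> first.\<close>

definition braid_op :: "('n::finite Uq \<Rightarrow> 'm::superspace \<Rightarrow> 'm) \<Rightarrow> ('r::finite, 'n) Aq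
    \<Rightarrow> ('r, 'n) Aq \<otimes> 'm \<Rightarrow> ('r, 'n) Aq \<otimes> 'm"
  where "braid_op act x =
    opend_app (induced scaleq (\<lambda>g. case g of TGen i a \<Rightarrow> Abs_opend (braid_gen act i a)) x)"

definition braid :: "('n::finite Uq \<Rightarrow> 'm::superspace \<Rightarrow> 'm) \<Rightarrow> 'm \<otimes> ('r::finite, 'n) Aq \<Rightarrow> ('r, 'n) Aq \<otimes> 'm"
  where "braid act = tlift (\<lambda>y x. braid_op act x (1 \<otimes> y))"

lemma
  fixes w :: "'a::superalgebra"
  shows tmap_times_linear: "qlinear (tmap ((*) w) id)"
    and tmap_times_tens: "tmap ((*) w) id (x \<otimes> y) = (w * x) \<otimes> y"
  by (intro tmap_linear qlinear_times qlinear_id) (simp only: tmap_id_right_tens[OF qlinear_times(2)])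

text \<open>When the first leg is already \<open>w\<close>, the last two maps of the composite for
  products in the second argument amount to left multiplication by \<open>w\<close>.\<close>

lemma tmap_mul_tassoc': "tmap mul id (tassoc' (w \<otimes> z)) = tmap ((*) w) id z"
proof -
  have "qlinear (\<lambda>z. tmap mul id (tassoc' (w \<otimes> z)))"
    by (rule qlinear_compose[OF qlinear_compose[OF qlinear_tens(2) tassoc'_linear] tmap_linear[OF mul_linear qlinear_id]])
  then show ?thesis
    by (rule qlinear_tensor_eqI[OF _ tmap_times_linear])
      (simp only: tmap_id_right_tens[OF mul_linear] tmap_times_tens tassoc'_tens mul_tens)
qed

context
  fixes act :: "'n::finite Uq \<Rightarrow> 'm::superspace \<Rightarrow> 'm"
  assumes act: "supermodule act"
begin

lemma braid_gen_bilinear: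
  "qbilinear (\<lambda>(x :: ('r::finite, 'n) Aq) y. \<Sum>d\<in>UNIV. (x * tA i d) \<otimes> Lhat act d a y)"
  by (intro qbilinear_sum qbilinearI)
    (simp_all add: salg_simps qlinear_add[OF Lhat_linear[OF supermoduleD(1)[OF act]]]
      qlinear_scale[OF Lhat_linear[OF supermoduleD(1)[OF act]]])

lemma braid_gen_linear: "qlinear (braid_gen act i a)"
  unfolding braid_gen_def by (rule tlift_linear[OF braid_gen_bilinear])

lemma braid_gen_tens: "braid_gen act i a (x \<otimes> y) = (\<Sum>d\<in>UNIV. (x * tA i d) \<otimes> Lhat act d a y)"
  unfolding braid_gen_def by (rule tlift_tens[OF braid_gen_bilinear])

lemma braid_gen_braid_gen: "braid_gen act j b (braid_gen act i a (x \<otimes> y)) =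
  (\<Sum>d\<in>UNIV. \<Sum>e\<in>UNIV. (x * (tA i d * tA j e)) \<otimes> Lhat act e b (Lhat act d a y))"
  by (simp only: braid_gen_tens qlinear_sum[OF braid_gen_linear] mult.assoc)

text \<open>The RTT relation in the first leg and the RLL relation in the second involve the same
  matrix \<open>Shat\<close>, so one can be traded for the other. The product of
  \<open>tA i a\<close> and \<open>tA j b\<close> acts by \<open>braid_gen act i a\<close>
  first.\<close>

lemma braid_gen_relation:
  "qq ^ of_bool (i = j) *\<^sub>q braid_gen act j b (braid_gen act i a z)
    + (xi * of_bool (j < i)) *\<^sub>q braid_gen act i b (braid_gen act j a z)
   = (\<Sum>c\<in>UNIV. \<Sum>e\<in>UNIV. Shat e a c b *\<^sub>q braid_gen act i e (braid_gen act j c z))"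
proof (induction z)
  case (tens x y)
  let ?L = "\<lambda>e b d a. Lhat act e b (Lhat act d a y)"
  have "qq ^ of_bool (i = j) *\<^sub>q braid_gen act j b (braid_gen act i a (x \<otimes> y))
      + (xi * of_bool (j < i)) *\<^sub>q braid_gen act i b (braid_gen act j a (x \<otimes> y))
    = (\<Sum>d\<in>UNIV. \<Sum>e\<in>UNIV. (x * (qq ^ of_bool (i = j) *\<^sub>q (tA i d * tA j e)
      + (xi * of_bool (j < i)) *\<^sub>q (tA j d * tA i e))) \<otimes> ?L e b d a)"
    by (simp only: braid_gen_braid_gen qspace.scale_sum_right sum.distrib[symmetric] tens_simps
        distrib_left scaleq_mult_right)
  \<comment> \<open>The relation of the coordinates in the first leg produces \<open>Shat\<close>,
    which is handed over to the second leg.\<close>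
  also have "\<dots> = (\<Sum>d\<in>UNIV. \<Sum>e\<in>UNIV. \<Sum>c\<in>UNIV. \<Sum>f\<in>UNIV.
      (x * (tA j c * tA i f)) \<otimes> (Shat f d c e *\<^sub>q ?L e b d a))"
    by (simp only: tA_relation sum_distrib_left tens_sum_left scaleq_mult_right tens_simps)
  also have "\<dots> = (\<Sum>c\<in>UNIV. \<Sum>f\<in>UNIV. (x * (tA j c * tA i f)) \<otimes>
      (\<Sum>d\<in>UNIV. \<Sum>e\<in>UNIV. Shat f d c e *\<^sub>q ?L e b d a))"
    by (subst sum_swap4) (simp only: tens_sum_right)
  \<comment> \<open>RLL moves \<open>Shat\<close> onto the fixed indices \<open>a\<close> and
    \<open>b\<close>, where the right-hand side of the relation has it.\<close>
  also have "\<dots> = (\<Sum>c\<in>UNIV. \<Sum>f\<in>UNIV. (x * (tA j c * tA i f)) \<otimes>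
      (\<Sum>d\<in>UNIV. \<Sum>e\<in>UNIV. Shat d a e b *\<^sub>q ?L f d c e))"
    by (simp only: Lhat_RLL[OF act])
  also have "\<dots> = (\<Sum>d\<in>UNIV. \<Sum>e\<in>UNIV. \<Sum>c\<in>UNIV. \<Sum>f\<in>UNIV.
      Shat d a e b *\<^sub>q ((x * (tA j c * tA i f)) \<otimes> ?L f d c e))"
    by (subst sum_swap4) (simp only: tens_sum_right tens_simps)
  also have "\<dots> = (\<Sum>c\<in>UNIV. \<Sum>e\<in>UNIV. Shat e a c b *\<^sub>q braid_gen act i e (braid_gen act j c (x \<otimes> y)))"
    unfolding braid_gen_braid_gen qspace.scale_sum_right by (rule sum.swap)
  finally show ?case .
next
  case (add x y)
  have "qq ^ of_bool (i = j) *\<^sub>q braid_gen act j b (braid_gen act i a (x + y))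
      + (xi * of_bool (j < i)) *\<^sub>q braid_gen act i b (braid_gen act j a (x + y))
    = (qq ^ of_bool (i = j) *\<^sub>q braid_gen act j b (braid_gen act i a x)
      + (xi * of_bool (j < i)) *\<^sub>q braid_gen act i b (braid_gen act j a x))
    + (qq ^ of_bool (i = j) *\<^sub>q braid_gen act j b (braid_gen act i a y)
      + (xi * of_bool (j < i)) *\<^sub>q braid_gen act i b (braid_gen act j a y))"
    by (simp add: qlinear_add[OF braid_gen_linear] scaleq_add_right)
  then show ?case
    unfolding add by (simp only: qlinear_add[OF braid_gen_linear] scaleq_add_right sum.distrib)
qed

lemma braid_respecting:
  "respecting scaleq (\<lambda>g :: ('r::finite, 'n) tgen. case g of TGen i a \<Rightarrow> Abs_opend (braid_gen act i a))"
proof (rule respecting_tgenI[OF q_algebra_opend])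
  fix i j :: "'r pidx" and a b :: "'n idx"
  have app_sum: "opend_app (sum f I) z = (\<Sum>i\<in>I. opend_app (f i) z)"
    for f :: "'x \<Rightarrow> (('r, 'n) Aq \<otimes> 'm) opend" and I z
    by (induction I rule: infinite_finite_induct) (simp_all add: zero_opend.rep_eq plus_opend.rep_eq)
  have app: "opend_app (Abs_opend (braid_gen act i a)) = braid_gen act i a" for i :: "'r pidx" and a
    by (simp add: Abs_opend_inverse braid_gen_linear)
  show "qq ^ of_bool (i = j) *\<^sub>q ((case TGen i a of TGen i a \<Rightarrow> Abs_opend (braid_gen act i a))
        * (case TGen j b of TGen i a \<Rightarrow> Abs_opend (braid_gen act i a)))
      + (xi * of_bool (j < i)) *\<^sub>q ((case TGen j a of TGen i a \<Rightarrow> Abs_opend (braid_gen act i a))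
        * (case TGen i b of TGen i a \<Rightarrow> Abs_opend (braid_gen act i a)))
    = (\<Sum>c\<in>UNIV. \<Sum>e\<in>UNIV. Shat e a c b *\<^sub>q ((case TGen j c of TGen i a \<Rightarrow> Abs_opend (braid_gen act i a))
        * (case TGen i e of TGen i a \<Rightarrow> Abs_opend (braid_gen act i a))))"
    unfolding opend_app_inject[symmetric] fun_eq_iff tgen.case
    by (simp only: app_sum plus_opend.rep_eq scaleq_opend.rep_eq times_opend.rep_eq app braid_gen_relation) simp
qed

lemma braid_op_linear: "qlinear (braid_op act x)"
  unfolding braid_op_def using opend_app by blast

lemma braid_op_1: "braid_op act 1 z = z"
  by (simp add: braid_op_def respecting.induced_1[OF braid_respecting] one_opend.rep_eq)

lemma braid_op_add: "braid_op act (x + y) z = braid_op act x z + braid_op act y z"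
  by (simp add: braid_op_def respecting.induced_add[OF braid_respecting] plus_opend.rep_eq)

lemma braid_op_scale: "braid_op act (c *\<^sub>q x) z = c *\<^sub>q braid_op act x z"
  by (simp add: braid_op_def respecting.induced_scale[OF braid_respecting] scaleq_opend.rep_eq)

lemma braid_op_mult: "braid_op act (x * y) z = braid_op act y (braid_op act x z)"
  by (simp add: braid_op_def respecting.induced_mult[OF braid_respecting] times_opend.rep_eq)

lemma braid_op_tA: "braid_op act (tA i a) = braid_gen act i a"
  by (simp add: braid_op_def tA_def respecting.induced_gen[OF braid_respecting]
      Abs_opend_inverse braid_gen_linear)

text \<open>Generators multiply the first leg from the right, so the action commutes with left
  multiplication there. Hence it is determined by its values on tensors
  \<open>1 \<otimes> y\<close>.\<close>

lemma braid_op_times: "braid_op act x (tmap ((*) w) id z) = tmap ((*) w) id (braid_op act x z)"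
proof (induction x arbitrary: z rule: Aq_induct)
  case (mult i a x)
  have "braid_gen act i a (tmap ((*) w) id z) = tmap ((*) w) id (braid_gen act i a z)"
    by (rule qlinear_tensor_eqI[OF qlinear_compose[OF tmap_times_linear braid_gen_linear]
          qlinear_compose[OF braid_gen_linear tmap_times_linear]])
      (simp only: tmap_times_tens braid_gen_tens qlinear_sum[OF tmap_times_linear] mult.assoc)
  then show ?case by (simp only: braid_op_mult braid_op_tA mult)
qed (simp_all only: braid_op_1 braid_op_scale braid_op_add qlinear_scale[OF tmap_times_linear]
    qlinear_add[OF tmap_times_linear])

lemma braid_bilinear: "qbilinear (\<lambda>y x. braid_op act x (1 \<otimes> y))"
  by (rule qbilinearI)
    (simp_all add: braid_op_add braid_op_scale tens_simps qlinear_add[OF braid_op_linear] qlinear_scale[OF braid_op_linear])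

lemma braid_linear: "qlinear (braid act)"
  unfolding braid_def by (rule tlift_linear[OF braid_bilinear])

lemma braid_tens: "braid act (y \<otimes> x) = braid_op act x (1 \<otimes> y)"
  unfolding braid_def by (rule tlift_tens[OF braid_bilinear])

lemma braid_1: "braid act (y \<otimes> 1) = 1 \<otimes> y"
  by (simp add: braid_tens braid_op_1)

lemma braid_tA: "braid act (y \<otimes> tA i a) = (\<Sum>d\<in>UNIV. tA i d \<otimes> Lhat act d a y)"
  by (simp add: braid_tens braid_op_tA braid_gen_tens)

lemma braid_op_tens: "braid_op act x (w \<otimes> y) = tmap ((*) w) id (braid act (y \<otimes> x))"
  using braid_op_times[of x w "1 \<otimes> y"] by (simp only: tmap_times_tens mult_1_right braid_tens)

text \<open>This recursion along words in the second argument drives the inductions for parity,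
  equivariance and multiplicativity in the first argument.\<close>

lemma braid_tA_mult:
  "braid act (y \<otimes> (tA i a * x)) = (\<Sum>d\<in>UNIV. tmap ((*) (tA i d)) id (braid act (Lhat act d a y \<otimes> x)))"
  unfolding braid_tens[of _ "tA i a * x"] braid_op_mult braid_op_tA braid_gen_tens mult_1_left
  by (simp only: qlinear_sum[OF braid_op_linear] braid_op_tens)

text \<open>By \<open>braid_op_tens\<close> the composite after the first braiding is the right
  action of \<open>x'\<close>; the claim is then that a product acts by its factors in turn.\<close>

lemma braid_mult_right:
  "braid act (y \<otimes> (x * x')) = tmap mul id (tassoc' (tmap id (braid act) (tassoc (braid act (y \<otimes> x) \<otimes> x'))))"
proof -
  have lin: "qlinear (\<lambda>z. tmap mul id (tassoc' (tmap id (braid act) (tassoc (z \<otimes> x')))))"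
    by (rule qlinear_compose[OF qlinear_compose[OF qlinear_compose[OF qlinear_compose[OF qlinear_tens(1)
        tassoc_linear] tmap_linear[OF qlinear_id braid_linear]] tassoc'_linear] tmap_linear[OF mul_linear qlinear_id]])
  have "tmap mul id (tassoc' (tmap id (braid act) (tassoc (z \<otimes> x')))) = braid_op act x' z" for z
    by (rule qlinear_tensor_eqI[OF lin braid_op_linear])
      (simp only: tassoc_tens tmap_id_left_tens[OF braid_linear] tmap_mul_tassoc' braid_op_tens)
  from this[of "braid act (y \<otimes> x)"] show ?thesis
    unfolding braid_tens[of _ "x * x'"] braid_op_mult braid_tens[of _ x, symmetric] by (rule sym)
qed

lemma braid_even: "braid act (hpart p z) = hpart p (braid act z)"
proof -
  have tA_part: "hpart p (tA i a * x) = tA i a * hpart (p + ipar a) x" for p i a and x :: "('r::finite, 'n) Aq"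
  proof (induction x rule: superspace_induct)
    case (hom s x)
    have "hpart p (tA i a * x) = (if p = ipar a + s then tA i a * x else 0)"
      by (rule hpart_hom[OF hpart_mult[OF hpart_tA hom]])
    moreover have "p = ipar a + s \<longleftrightarrow> p + ipar a = s"
      by (cases p; cases "ipar a"; cases s) simp_all
    ultimately show ?case
      unfolding hpart_hom[OF hom] by (cases "p + ipar a = s") (simp_all only: simp_thms if_True if_False mult_zero_right)
  qed (simp add: hpart_add distrib_left)
  have tmap_part: "hpart p (tmap ((*) (tA i a :: ('r, 'n) Aq)) id z) = tmap ((*) (tA i a)) id (hpart (p + ipar a) z)"
    for p i a and z :: "('r::finite, 'n) Aq \<otimes> 'm"
  proof (induction z rule: tensor_induct_hom)
    case (tens x y r s)
    have h: "hpart (ipar a + r) (tA i a * x) = tA i a * x" by (rule hpart_mult[OF hpart_tA tens(1)])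
    have "p = ipar a + r + s \<longleftrightarrow> p + ipar a = r + s"
      by (cases p; cases "ipar a"; cases s; cases r) simp_all
    then show ?case
      unfolding tmap_times_tens hpart_tens_hom[OF h tens(2)] hpart_tens_hom[OF tens]
      by (cases "p + ipar a = r + s") (simp_all only: simp_thms if_True if_False tmap_times_tens qlinear_0[OF tmap_times_linear])
  qed (simp only: hpart_add qlinear_add[OF tmap_times_linear])
  have L: "hpart (p + ipar a + ipar b) (Lhat act a b y) = Lhat act a b y" if "hpart p y = y" for p a b y
  proof -
    have "p + ipar a + ipar b = ipar a + ipar b + p" by (simp only: add_ac)
    then show ?thesis
      by (simp only: Lhat_hom[OF supermoduleD(1)[OF act] that] hpart_scaleq supermoduleD(4)[OF act hpart_LU that])
  qed
  \<comment> \<open>Stated for a component of an arbitrary \<open>x\<close>, because the induction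
    over words and sums does not stay among homogeneous elements.\<close>
  have hom: "hpart p y = y \<Longrightarrow> hpart (p + s) (braid act (y \<otimes> hpart s x)) = braid act (y \<otimes> hpart s x)"
    for p s y and x :: "('r::finite, 'n) Aq"
  proof (induction x arbitrary: p s y rule: Aq_induct)
    case one
    have s: "hpart s (1 :: ('r, 'n) Aq) = (if s = 0 then 1 else 0)" by (rule hpart_hom[OF hpart_one])
    show ?case
    proof (cases "s = 0")
      case True
      then show ?thesis
        by (simp only: add_0_left add_0_right hpart_one braid_1 hpart_tens_hom[OF hpart_one one] simp_thms if_True)
    next
      case False
      then show ?thesis
        by (simp only: s if_False tens_0 qlinear_0[OF braid_linear] hpart_0)
    qed
  next
    case (mult i a x)
    show ?case
      unfolding tA_part braid_tA_mult qlinear_sum[OF hpart_linear] tmap_part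
    proof (intro sum.cong refl arg_cong[where f = "tmap _ id"])
      fix d :: "'n idx"
      \<comment> \<open>The two shifts by \<open>ipar a\<close>, from \<open>Lhat act d a\<close>
        and from removing \<open>tA i a\<close>, cancel; the remaining \<open>ipar d\<close> is the
        parity of \<open>tA i d\<close>.\<close>
      have "p + ipar d + ipar a + (s + ipar a) = p + s + ipar d"
        by (cases p; cases s; cases "ipar d"; cases "ipar a") simp_all
      with mult.IH[OF L[OF mult.prems, of d a], of "s + ipar a"]
      show "hpart (p + s + ipar d) (braid act (Lhat act d a y \<otimes> hpart (s + ipar a) x))
          = braid act (Lhat act d a y \<otimes> hpart (s + ipar a) x)"
        by (simp only:)
    qed
  qed (simp_all only: hpart_scaleq hpart_add tens_simps qlinear_scale[OF braid_linear] qlinear_add[OF braid_linear])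
  show ?thesis
  proof (induction z rule: tensor_induct_hom)
    case (tens y x r s)
    have "hpart (r + s) (braid act (y \<otimes> x)) = braid act (y \<otimes> x)"
      using hom[OF tens(1), of s x] by (simp only: tens(2))
    from hpart_hom[OF this] show ?case
      by (cases "p = r + s") (simp_all only: hpart_tens_hom[OF tens] simp_thms if_True if_False qlinear_0[OF braid_linear])
  qed (simp only: hpart_add qlinear_add[OF braid_linear])
qed

end

section \<open>Equivariance and multiplicativity of the braiding\<close>

lemma coord_actionD:
  assumes "coord_action act"
  shows "supermodule_superalgebra act" "supermodule act"
  using assms by (simp_all add: coord_action_def supermodule_superalgebra_def)

text \<open>The sign \<open>?k\<close> of the defining formula squares to one; multiplied by the
  sign \<open>?l\<close> of \<open>Lhat\<close> it turns \<open>Smat\<close> into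
  \<open>Shat\<close>, by evenness of the entries.\<close>

lemma Lhat_tA:
  assumes "coord_action act"
  shows "Lhat act a b (tA i c) = (\<Sum>d\<in>UNIV. Shat d c a b *\<^sub>q tA i d)"
proof -
  let ?k = "koszul ((ipar a + ipar b) * ipar c)" and ?l = "koszul (ipar b * (ipar c + ipar a + 1))"
  have "?k *\<^sub>q act (LU a b) (tA i c)
      = (\<Sum>d\<in>UNIV. (koszul (ipar d * (ipar d + ipar c)) * Smat d c a b) *\<^sub>q tA i d)"
    using assms by (simp add: coord_action_def)
  from arg_cong[OF this, of "\<lambda>x. (?l * ?k) *\<^sub>q x"]
  have "?l *\<^sub>q (?k * ?k) *\<^sub>q act (LU a b) (tA i c) = (\<Sum>d\<in>UNIV.
      (?l * ?k * (koszul (ipar d * (ipar d + ipar c)) * Smat d c a b)) *\<^sub>q tA i d)"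
    by (simp only: qspace.scale_sum_right scaleq_scaleq mult.assoc)
  moreover have "?k * ?k = 1" by (simp add: koszul_def)
  moreover have "?l * ?k * (koszul (ipar d * (ipar d + ipar c)) * Smat d c a b) = Shat d c a b" for d
  proof (cases "Smat d c a b = 0")
    case False
    have "koszul (b * (c + a + 1)) * koszul ((a + b) * c) * koszul (d * (d + c)) = koszul (d * b + d + c)"
      if "d + c + a + b = 0" for a b c d
      using that by (cases a; cases b; cases c; cases d) simp_all
    from this[OF Smat_even[OF False]] show ?thesis by (simp only: Shat_def mult.assoc[symmetric])
  qed (simp only: Shat_def mult_zero_right)
  ultimately show ?thesis
    by (simp only: Lhat_hom[OF supermoduleD(1)[OF coord_actionD(2)[OF assms]] hpart_tA] scaleq_one)
qed

lemma pgen_LU: "\<exists>i j. pgen g = LU i j"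
proof -
  obtain i j where g: "Rep_lgen g = (i, j)" by force
  then have "i \<le> j" using Rep_lgen[of g] by simp
  then have "pgen g = LU i j" by (simp add: LU_def flip: g) (simp add: Rep_lgen_inverse)
  then show ?thesis by blast
qed

lemma sum_rotate:
  "(\<Sum>k\<in>D. \<Sum>c\<in>A. \<Sum>f\<in>C. \<Sum>d\<in>B. g k c f d) = (\<Sum>c\<in>A. \<Sum>d\<in>B. \<Sum>f\<in>C. \<Sum>k\<in>D. g k c f d)"
proof -
  have "(\<Sum>k\<in>D. \<Sum>c\<in>A. \<Sum>f\<in>C. \<Sum>d\<in>B. g k c f d) = (\<Sum>c\<in>A. \<Sum>k\<in>D. \<Sum>f\<in>C. \<Sum>d\<in>B. g k c f d)"
    by (rule sum.swap)
  also have "\<dots> = (\<Sum>c\<in>A. \<Sum>k\<in>D. \<Sum>d\<in>B. \<Sum>f\<in>C. g k c f d)"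
    by (intro sum.cong refl) (rule sum.swap)
  also have "\<dots> = (\<Sum>c\<in>A. \<Sum>d\<in>B. \<Sum>k\<in>D. \<Sum>f\<in>C. g k c f d)"
    by (intro sum.cong refl) (rule sum.swap)
  also have "\<dots> = (\<Sum>c\<in>A. \<Sum>d\<in>B. \<Sum>f\<in>C. \<Sum>k\<in>D. g k c f d)"
    by (intro sum.cong refl) (rule sum.swap)
  finally show ?thesis .
qed

lemma
  fixes y :: "'a::superalgebra"
  shows tmap_times_right_linear: "qlinear (tmap id (\<lambda>v. v * y))"
    and tmap_times_right_tens: "tmap id (\<lambda>v. v * y) (w \<otimes> v) = w \<otimes> (v * y)"
  by (rule tmap_linear[OF qlinear_id qlinear_times(1)]) (simp only: tmap_id_left_tens[OF qlinear_times(1)])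

lemma tmap_mul_tassoc: "tmap id mul (tassoc (z \<otimes> y)) = tmap id (\<lambda>v. v * y) z"
proof -
  have "qlinear (\<lambda>z. tmap id mul (tassoc (z \<otimes> y)))"
    by (rule qlinear_compose[OF qlinear_compose[OF qlinear_tens(1) tassoc_linear] tmap_linear[OF qlinear_id mul_linear]])
  then show ?thesis
    by (rule qlinear_tensor_eqI[OF _ tmap_times_right_linear])
      (simp only: tmap_id_left_tens[OF mul_linear] tmap_times_right_tens tassoc_tens mul_tens)
qed

lemma tmap_times_commute:
  fixes w :: "'a::superalgebra" and y :: "'b::superalgebra"
  shows "tmap id (\<lambda>v. v * y) (tmap ((*) w) id z) = tmap ((*) w) id (tmap id (\<lambda>v. v * y) z)"
  by (rule qlinear_tensor_eqI[OF qlinear_compose[OF tmap_times_linear tmap_times_right_linear]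
        qlinear_compose[OF tmap_times_right_linear tmap_times_linear]])
    (simp only: tmap_times_tens tmap_times_right_tens)

lemma
  fixes v w :: "'a::superalgebra"
  shows tmap_times_add: "tmap ((*) (v + w)) id z = tmap ((*) v) id z + tmap ((*) w) id z"
    and tmap_times_scale: "tmap ((*) (c *\<^sub>q w)) id z = c *\<^sub>q tmap ((*) w) id z"
  by (induction z) (simp_all only: tmap_times_tens salg_simps qlinear_add[OF tmap_times_linear] add_ac)

lemma tmap_times_sum: "tmap ((*) (\<Sum>i\<in>I. w i)) id z = (\<Sum>i\<in>I. tmap ((*) (w i)) id z)"
  for w :: "'i \<Rightarrow> 'a::superalgebra"
  by (rule qlinear_sum[of "\<lambda>w. tmap ((*) w) id z"]) (simp only: qlinear_iff tmap_times_add tmap_times_scale simp_thms)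

lemma sum_of_bool: "(\<Sum>d\<in>UNIV. of_bool (d = a) *\<^sub>q f d) = f a"
  "(\<Sum>d\<in>UNIV. of_bool (a = d) *\<^sub>q f d) = f a" for f :: "'n::finite idx \<Rightarrow> 'a::qspace"
proof -
  have "(\<Sum>d\<in>UNIV. of_bool (d = a) *\<^sub>q f d) = (\<Sum>d\<in>UNIV. if d = a then f d else 0)"
    by (intro sum.cong) (simp_all add: scaleq_one)
  then show "(\<Sum>d\<in>UNIV. of_bool (d = a) *\<^sub>q f d) = f a" by simp
  then show "(\<Sum>d\<in>UNIV. of_bool (a = d) *\<^sub>q f d) = f a" by (simp only: eq_commute)
qed

section \<open>Equivariance of the braiding\<close>

context
  fixes act :: "'n::finite Uq \<Rightarrow> 'm::superspace \<Rightarrow> 'm" and actA :: "'n Uq \<Rightarrow> ('r::finite, 'n) Aq \<Rightarrow> ('r, 'n) Aq"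
  assumes act: "supermodule act" and actA: "coord_action actA"
begin

lemmas supA = coord_actionD(2)[OF actA]

text \<open>On pure tensors both sides expand into the same threefold matrix product and differ only
  in the order of summation.\<close>

lemma Lhat_tmap_times: "Lhat (tensor_act actA act) p q (tmap ((*) w) id z)
    = (\<Sum>c\<in>UNIV. tmap ((*) (Lhat actA p c w)) id (Lhat (tensor_act actA act) c q z))"
proof -
  have l: "qlinear (\<lambda>z. Lhat (tensor_act actA act) p q (tmap ((*) w) id z))"
    by (rule qlinear_compose[OF tmap_times_linear Lhat_linear[OF tensor_act_bilinear[OF supA act]]])
  have r: "qlinear (\<lambda>z. \<Sum>c\<in>UNIV. tmap ((*) (Lhat actA p c w)) id (Lhat (tensor_act actA act) c q z))"
    by (intro qlinear_sum_fun) (rule qlinear_compose[OF Lhat_linear[OF tensor_act_bilinear[OF supA act]] tmap_times_linear])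
  have t: "Lhat (tensor_act actA act) p q (tmap ((*) w) id (x \<otimes> y))
      = (\<Sum>c\<in>UNIV. tmap ((*) (Lhat actA p c w)) id (Lhat (tensor_act actA act) c q (x \<otimes> y)))" for x y
    by (simp only: tmap_times_tens Lhat_tens[OF supA act] Lhat_mult[OF coord_actionD(1)[OF actA]]
        qlinear_sum[OF tmap_times_linear] tens_sum_left) (rule sum.swap)
  show ?thesis by (rule qlinear_tensor_eqI[OF l r t])
qed

text \<open>The left-hand side is \<open>Lhat\<close> on \<open>y \<otimes> x\<close> followed by
  the braiding. Splitting off a generator from \<open>x\<close> leaves two \<open>Lhat\<close>
  operators on \<open>y\<close>, whose order RLL reverses; the induction hypothesis is then used at
  a changed \<open>y\<close> and changed indices.\<close>

lemma braid_Lhat_tens: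
  "(\<Sum>k\<in>UNIV. braid act (Lhat act p k y \<otimes> Lhat actA k q x)) = Lhat (tensor_act actA act) p q (braid act (y \<otimes> x))"
proof (induction x arbitrary: y p q rule: Aq_induct)
  case one
  have "(\<Sum>k\<in>UNIV. braid act (Lhat act p k y \<otimes> Lhat actA k q 1)) = 1 \<otimes> Lhat act p q y"
    by (simp only: Lhat_1[OF coord_actionD(1)[OF actA]] tens_simps qlinear_scale[OF braid_linear[OF act]]
        braid_1[OF act] sum_of_bool)
  also have "\<dots> = Lhat (tensor_act actA act) p q (braid act (y \<otimes> 1))"
    by (simp only: Lhat_tens[OF supA act] Lhat_1[OF coord_actionD(1)[OF actA]] tens_simps
        braid_1[OF act] sum_of_bool)
  finally show ?case .
next
  case (scale c x)
  then show ?case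
    by (simp only: tens_simps qlinear_scale[OF braid_linear[OF act]] qspace.scale_sum_right[symmetric]
       qlinear_scale[OF Lhat_linear[OF tensor_act_bilinear[OF supA act]]] qlinear_scale[OF Lhat_linear[OF supermoduleD(1)[OF supA]]])
next
  case (add x x')
  then show ?case
    by (simp only: tens_simps qlinear_add[OF braid_linear[OF act]] sum.distrib
       qlinear_add[OF Lhat_linear[OF tensor_act_bilinear[OF supA act]]] qlinear_add[OF Lhat_linear[OF supermoduleD(1)[OF supA]]])
next
  case (mult i a x)
  let ?G = "\<lambda>d c Y. tmap ((*) (tA i d)) id (braid act (Y \<otimes> Lhat actA c q x))"
  have G: "qlinear (?G d c)" for d c
    by (rule qlinear_compose[OF qlinear_compose[OF qlinear_tens(1) braid_linear[OF act]] tmap_times_linear])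
  have "(\<Sum>k\<in>UNIV. braid act (Lhat act p k y \<otimes> Lhat actA k q (tA i a * x)))
      = (\<Sum>k\<in>UNIV. \<Sum>c\<in>UNIV. \<Sum>f\<in>UNIV. \<Sum>d\<in>UNIV. Shat f a k c *\<^sub>q ?G d c (Lhat act d f (Lhat act p k y)))"
    by (simp only: Lhat_mult[OF coord_actionD(1)[OF actA]] Lhat_tA[OF actA] sum_distrib_right tens_sum_right
        scaleq_mult_left tens_simps qlinear_sum[OF braid_linear[OF act]] qlinear_scale[OF braid_linear[OF act]]
        braid_tA_mult[OF act] qspace.scale_sum_right)
  also have "\<dots> = (\<Sum>c\<in>UNIV. \<Sum>d\<in>UNIV. \<Sum>f\<in>UNIV. \<Sum>k\<in>UNIV. Shat f a k c *\<^sub>q ?G d c (Lhat act d f (Lhat act p k y)))"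
    by (rule sum_rotate)
  also have "\<dots> = (\<Sum>c\<in>UNIV. \<Sum>d\<in>UNIV. ?G d c (\<Sum>f\<in>UNIV. \<Sum>k\<in>UNIV. Shat f a k c *\<^sub>q Lhat act d f (Lhat act p k y)))"
    by (simp only: qlinear_sum[OF G] qlinear_scale[OF G])
  \<comment> \<open>Now \<open>Shat\<close> has the indices that \<open>Lhat_tA\<close> gives for
    \<open>Lhat actA p k (tA i f)\<close>, the action on the first leg after braiding.\<close>
  also have "\<dots> = (\<Sum>c\<in>UNIV. \<Sum>d\<in>UNIV. ?G d c (\<Sum>f\<in>UNIV. \<Sum>k\<in>UNIV. Shat d f p k *\<^sub>q Lhat act k c (Lhat act f a y)))"
    by (simp only: Lhat_RLL[OF act, symmetric])
  also have "\<dots> = (\<Sum>c\<in>UNIV. \<Sum>d\<in>UNIV. \<Sum>f\<in>UNIV. \<Sum>k\<in>UNIV. Shat d f p k *\<^sub>q ?G d c (Lhat act k c (Lhat act f a y)))"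
    by (simp only: qlinear_sum[OF G] qlinear_scale[OF G])
  also have "\<dots> = (\<Sum>f\<in>UNIV. \<Sum>k\<in>UNIV. \<Sum>c\<in>UNIV. \<Sum>d\<in>UNIV. Shat d f p k *\<^sub>q ?G d c (Lhat act k c (Lhat act f a y)))"
    by (rule sum_swap4)
  also have "\<dots> = (\<Sum>f\<in>UNIV. \<Sum>k\<in>UNIV. \<Sum>d\<in>UNIV. Shat d f p k *\<^sub>q
      tmap ((*) (tA i d)) id (\<Sum>c\<in>UNIV. braid act (Lhat act k c (Lhat act f a y) \<otimes> Lhat actA c q x)))"
    unfolding qlinear_sum[OF tmap_times_linear] qspace.scale_sum_right by (intro sum.cong refl sum.swap)
  also have "\<dots> = Lhat (tensor_act actA act) p q (\<Sum>f\<in>UNIV. tmap ((*) (tA i f)) id (braid act (Lhat act f a y \<otimes> x)))"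
    by (simp only: qlinear_sum[OF Lhat_linear[OF tensor_act_bilinear[OF supA act]]] Lhat_tmap_times
        Lhat_tA[OF actA] tmap_times_sum tmap_times_scale mult)
  also have "\<dots> = Lhat (tensor_act actA act) p q (braid act (y \<otimes> (tA i a * x)))"
    by (simp only: braid_tA_mult[OF act])
  finally show ?case .
qed

lemma braid_Lhat:
  "braid act (Lhat (tensor_act act actA) p q z) = Lhat (tensor_act actA act) p q (braid act z)"
  by (rule qlinear_tensor_eqI[OF qlinear_compose[OF Lhat_linear[OF tensor_act_bilinear[OF act supA]] braid_linear[OF act]]
     qlinear_compose[OF braid_linear[OF act] Lhat_linear[OF tensor_act_bilinear[OF supA act]]]])
    (simp only: Lhat_tens[OF act supA] qlinear_sum[OF braid_linear[OF act]] braid_Lhat_tens)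

text \<open>Both actions are multiplicative in \<open>u\<close>, so the generators suffice; for
  these, evenness of the braiding allows the signs in \<open>braid_Lhat\<close> to be
  removed.\<close>

lemma braid_supermodule_hom: "supermodule_hom (tensor_act act actA) (tensor_act actA act) (braid act)"
proof -
  have "braid act (tensor_act act actA u z) = tensor_act actA act u (braid act z)" for u z
  proof (induction u arbitrary: z)
    case (mult g u)
    obtain i j where g: "pgen g = LU i j" using pgen_LU by blast
    have "braid act (tensor_act act actA (LU i j) z) = tensor_act actA act (LU i j) (braid act z)" for z
      by (rule LU_equivariant[where f = "braid act", OF tensor_act_bilinear[OF act supA] tensor_act_bilinear[OF supA act]
           braid_linear[OF act] braid_even[OF act] braid_Lhat])
    then show ?case
      by (simp only: g tensor_act_mult[OF act supA] tensor_act_mult[OF supA act] mult)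
  qed (simp_all only: tensor_act_1[OF act supA] tensor_act_1[OF supA act]
      qbilinearD[OF tensor_act_bilinear[OF act supA]] qbilinearD[OF tensor_act_bilinear[OF supA act]]
      qlinear_add[OF braid_linear[OF act]] qlinear_scale[OF braid_linear[OF act]])
  then show ?thesis
    by (simp only: supermodule_hom_def braid_linear[OF act] braid_even[OF act] simp_thms)
qed

end

section \<open>Multiplicativity in the first argument\<close>

context
  fixes act :: "'n::finite Uq \<Rightarrow> 'b::superalgebra \<Rightarrow> 'b"
  assumes actB: "supermodule_superalgebra act"
begin

lemma supB: "supermodule act"
  using actB by (simp add: supermodule_superalgebra_def)

lemmas linB = braid_linear[OF supB]

text \<open>The operators \<open>Lhat\<close> act on the unit as an identity matrix, so each
  generator passes it unchanged.\<close>

lemma braid_1_left: "braid act (1 \<otimes> x) = x \<otimes> 1"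
proof (induction x rule: Aq_induct)
  case (mult i a x)
  show ?case
    by (simp only: braid_tA_mult[OF supB] Lhat_1[OF actB] tens_simps qlinear_scale[OF linB]
        qlinear_scale[OF tmap_times_linear] sum_of_bool mult tmap_times_tens)
qed (simp_all only: braid_1[OF supB] tens_simps qlinear_scale[OF linB] qlinear_add[OF linB])

text \<open>The composite for products in the first argument obeys the recursion of
  \<open>braid_tA_mult\<close> when a generator is split off from the first leg of
  \<open>z\<close>.\<close>

lemma braid_tmap_times:
  "tmap id mul (tassoc (tmap (braid act) id (tassoc' (y \<otimes> tmap ((*) (tA i c)) id z))))
    = (\<Sum>d\<in>UNIV. tmap ((*) (tA i d)) id (tmap id mul (tassoc (tmap (braid act) id (tassoc' (Lhat act d c y \<otimes> z))))))"
proof -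
  have lin: "qlinear (\<lambda>z. tmap id mul (tassoc (tmap (braid act) id (tassoc' (y \<otimes> z)))))" for y
    by (rule qlinear_compose[OF qlinear_compose[OF qlinear_compose[OF qlinear_compose[OF qlinear_tens(2)
        tassoc'_linear] tmap_linear[OF linB qlinear_id]] tassoc_linear] tmap_linear[OF qlinear_id mul_linear]])
  have l: "qlinear (\<lambda>z. tmap id mul (tassoc (tmap (braid act) id (tassoc' (y \<otimes> tmap ((*) (tA i c)) id z)))))"
    by (rule qlinear_compose[OF tmap_times_linear lin])
  have r: "qlinear (\<lambda>z. \<Sum>d\<in>UNIV. tmap ((*) (tA i d)) id (tmap id mul (tassoc (tmap (braid act) id (tassoc' (Lhat act d c y \<otimes> z))))))"
    by (intro qlinear_sum_fun) (rule qlinear_compose[OF lin tmap_times_linear])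
  have t: "tmap id mul (tassoc (tmap (braid act) id (tassoc' (y \<otimes> tmap ((*) (tA i c)) id (w \<otimes> y')))))
    = (\<Sum>d\<in>UNIV. tmap ((*) (tA i d)) id (tmap id mul (tassoc (tmap (braid act) id (tassoc' (Lhat act d c y \<otimes> (w \<otimes> y')))))))"
    for w y'
    by (simp only: tmap_times_tens tassoc'_tens tmap_id_right_tens[OF linB] tmap_mul_tassoc braid_tA_mult[OF supB]
       qlinear_sum[OF tmap_times_right_linear] tmap_times_commute)
  show ?thesis by (rule qlinear_tensor_eqI[OF l r t])
qed

text \<open>Passing a generator across \<open>y * y'\<close> at once gives the intermediate index of
  \<open>Lhat_mult\<close>; passing it across \<open>y'\<close> and then \<open>y\<close> gives the
  same sum, by \<open>braid_tmap_times\<close>.\<close>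

lemma braid_mult_left: "braid act ((y * y') \<otimes> x)
    = tmap id mul (tassoc (tmap (braid act) id (tassoc' (y \<otimes> braid act (y' \<otimes> x)))))"
proof (induction x arbitrary: y y' rule: Aq_induct)
  case one
  show ?case
    by (simp only: braid_1[OF supB] tassoc'_tens tmap_id_right_tens[OF linB] tmap_mul_tassoc
        tmap_times_right_tens)
next
  case (mult i a x)
  have lin: "qlinear (\<lambda>z. tmap id mul (tassoc (tmap (braid act) id (tassoc' (y \<otimes> z)))))" for y
    by (rule qlinear_compose[OF qlinear_compose[OF qlinear_compose[OF qlinear_compose[OF qlinear_tens(2)
        tassoc'_linear] tmap_linear[OF linB qlinear_id]] tassoc_linear] tmap_linear[OF qlinear_id mul_linear]])
  have "braid act ((y * y') \<otimes> (tA i a * x)) = (\<Sum>d\<in>UNIV. \<Sum>c\<in>UNIV. tmap ((*) (tA i d)) id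
      (tmap id mul (tassoc (tmap (braid act) id (tassoc' (Lhat act d c y \<otimes> braid act (Lhat act c a y' \<otimes> x)))))))"
    by (simp only: braid_tA_mult[OF supB] Lhat_mult[OF actB] tens_sum_left qlinear_sum[OF linB]
        qlinear_sum[OF tmap_times_linear] mult)
  also have "\<dots> = (\<Sum>c\<in>UNIV. tmap id mul (tassoc (tmap (braid act) id (tassoc'
      (y \<otimes> tmap ((*) (tA i c)) id (braid act (Lhat act c a y' \<otimes> x)))))))"
    unfolding braid_tmap_times by (rule sum.swap)
  also have "\<dots> = tmap id mul (tassoc (tmap (braid act) id (tassoc' (y \<otimes> braid act (y' \<otimes> (tA i a * x))))))"
    unfolding braid_tA_mult[OF supB] qlinear_sum[OF lin] ..
  finally show ?case .
qed (simp_all only: tens_simps qlinear_scale[OF linB] qlinear_add[OF linB] qlinear_add[OF tassoc'_linear]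
  qlinear_scale[OF tassoc'_linear] qlinear_add[OF tassoc_linear] qlinear_scale[OF tassoc_linear]
  qlinear_add[OF tmap_linear[OF linB qlinear_id]] qlinear_scale[OF tmap_linear[OF linB qlinear_id]]
  qlinear_add[OF tmap_linear[OF qlinear_id mul_linear]] qlinear_scale[OF tmap_linear[OF qlinear_id mul_linear]])

end

section \<open>Values on generators and uniqueness\<close>

lemma braid_tA_tA:
  assumes "coord_action act"
  shows "braid act (tA j b \<otimes> tA i a) = (\<Sum>d\<in>UNIV. \<Sum>c\<in>UNIV. Shat c b d a *\<^sub>q (tA i d \<otimes> tA j c))"
  by (simp only: braid_tA[OF coord_actionD(2)[OF assms]] Lhat_tA[OF assms] tens_sum_right tens_simps)

text \<open>The multiplicativity rules reduce everything to pairs of generators: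
  \<open>right\<close> handles words in the second argument, then \<open>left\<close> handles words
  in the first.\<close>

lemma braid_unique:
  fixes act :: "'n::finite Uq \<Rightarrow> ('k::finite, 'n) Aq \<Rightarrow> ('k, 'n) Aq"
    and \<Theta> :: "('k, 'n) Aq \<otimes> ('r::finite, 'n) Aq \<Rightarrow> ('r, 'n) Aq \<otimes> ('k, 'n) Aq"
  assumes act: "coord_action act" and lin: "qlinear \<Theta>"
    and right: "\<And>y x x'. \<Theta> (y \<otimes> (x * x')) = tmap mul id (tassoc' (tmap id \<Theta> (tassoc (\<Theta> (y \<otimes> x) \<otimes> x'))))"
    and left: "\<And>y y' x. \<Theta> ((y * y') \<otimes> x) = tmap id mul (tassoc (tmap \<Theta> id (tassoc' (y \<otimes> \<Theta> (y' \<otimes> x)))))"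
    and unit: "\<And>x. \<Theta> (1 \<otimes> x) = x \<otimes> 1" "\<And>y. \<Theta> (y \<otimes> 1) = 1 \<otimes> y"
    and gen: "\<And>j b i a. \<Theta> (tA j b \<otimes> tA i a) = braid act (tA j b \<otimes> tA i a)"
  shows "\<Theta> = braid act"
proof
  fix z
  note sup = coord_actionD[OF act]
  note linb = braid_linear[OF sup(2)]
  \<comment> \<open>The index \<open>b\<close> must vary, because exchanging \<open>tA j b\<close>
    with \<open>tA i a\<close> leaves a combination of generators \<open>tA j c\<close> in front of
    the rest of the word.\<close>
  have step1: "\<Theta> (tA j b \<otimes> x) = braid act (tA j b \<otimes> x)" for j b x
  proof (induction x arbitrary: b rule: Aq_induct)
    case (mult i a x)
    let ?F = "\<lambda>\<theta>. tmap mul id (tassoc' (tmap id \<theta> (tassoc ((\<Sum>d\<in>UNIV. \<Sum>c\<in>UNIV. Shat c b d a *\<^sub>q (tA i d \<otimes> tA j c)) \<otimes> x))))"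
    have F: "?F \<theta> = (\<Sum>d\<in>UNIV. \<Sum>c\<in>UNIV. Shat c b d a *\<^sub>q tmap mul id (tassoc' (tA i d \<otimes> \<theta> (tA j c \<otimes> x))))"
      if "qlinear \<theta>" for \<theta>
      by (simp only: tens_sum_left tens_simps qlinear_sum[OF tassoc_linear] qlinear_scale[OF tassoc_linear] tassoc_tens
          qlinear_sum[OF tmap_linear[OF qlinear_id that]] qlinear_scale[OF tmap_linear[OF qlinear_id that]]
          tmap_id_left_tens[OF that] qlinear_sum[OF tassoc'_linear] qlinear_scale[OF tassoc'_linear]
          qlinear_sum[OF tmap_linear[OF mul_linear qlinear_id]] qlinear_scale[OF tmap_linear[OF mul_linear qlinear_id]])
    have "?F \<Theta> = ?F (braid act)" by (simp only: F[OF lin] F[OF linb] mult)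
    then show ?case
      by (simp only: right braid_mult_right[OF sup(2)] gen braid_tA_tA[OF act])
  qed (simp_all only: unit braid_1[OF sup(2)] tens_simps qlinear_scale[OF lin] qlinear_scale[OF linb]
     qlinear_add[OF lin] qlinear_add[OF linb])
  have step2: "\<Theta> (y \<otimes> x) = braid act (y \<otimes> x)" for y x
  proof (induction y rule: Aq_induct)
    case (mult j b y)
    have G: "qlinear (\<lambda>z. tmap id mul (tassoc (tmap \<theta> id (tassoc' (tA j b \<otimes> z)))))" if "qlinear \<theta>"
      for \<theta> :: "('k, 'n) Aq \<otimes> ('r, 'n) Aq \<Rightarrow> ('r, 'n) Aq \<otimes> ('k, 'n) Aq"
      by (rule qlinear_compose[OF qlinear_compose[OF qlinear_compose[OF qlinear_compose[OF qlinear_tens(2)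
        tassoc'_linear] tmap_linear[OF that qlinear_id]] tassoc_linear] tmap_linear[OF qlinear_id mul_linear]])
    \<comment> \<open>The induction hypothesis settles the inner braiding; the outer one only braids
      \<open>tA j b\<close>, so \<open>step1\<close> identifies it on every
      \<open>z\<close>.\<close>
    have "tmap id mul (tassoc (tmap \<Theta> id (tassoc' (tA j b \<otimes> z))))
        = tmap id mul (tassoc (tmap (braid act) id (tassoc' (tA j b \<otimes> z))))" for z
      by (rule qlinear_tensor_eqI[OF G[OF lin] G[OF linb]])
        (simp only: tassoc'_tens tmap_id_right_tens[OF lin] tmap_id_right_tens[OF linb] step1)
    then show ?case
      by (simp only: left braid_mult_left[OF sup(1)] mult)
  qed (simp_all only: unit braid_1_left[OF sup(1)] tens_simps qlinear_scale[OF lin] qlinear_scale[OF linb]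
     qlinear_add[OF lin] qlinear_add[OF linb])
  show "\<Theta> z = braid act z"
    by (rule qlinear_tensor_eqI[OF lin linb step2])
qed

theorem proposition3p3:
  fixes \<Phi>\<^sub>k :: "'n::finite Uq \<Rightarrow> ('k::finite, 'n) Aq \<Rightarrow> ('k, 'n) Aq"
    and \<Phi>\<^sub>r :: "'n Uq \<Rightarrow> ('r::finite, 'n) Aq \<Rightarrow> ('r, 'n) Aq"
  assumes "coord_action \<Phi>\<^sub>k" and "coord_action \<Phi>\<^sub>r"
  shows "\<exists>!\<Theta> :: ('k, 'n) Aq \<otimes> ('r, 'n) Aq \<Rightarrow> ('r, 'n) Aq \<otimes> ('k, 'n) Aq.
    supermodule_hom (tensor_act \<Phi>\<^sub>k \<Phi>\<^sub>r) (tensor_act \<Phi>\<^sub>r \<Phi>\<^sub>k) \<Theta> \<and>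
    \<Theta> \<circ> tmap id mul = tmap mul id \<circ> tassoc' \<circ> tmap id \<Theta> \<circ> tassoc \<circ> tmap \<Theta> id \<circ> tassoc' \<and>
    \<Theta> \<circ> tmap mul id = tmap id mul \<circ> tassoc \<circ> tmap \<Theta> id \<circ> tassoc' \<circ> tmap id \<Theta> \<circ> tassoc \<and>
    (\<forall>x. \<Theta> (1 \<otimes> x) = x \<otimes> 1) \<and>
    (\<forall>y. \<Theta> (y \<otimes> 1) = 1 \<otimes> y) \<and>
    (\<forall>j b i a. \<Theta> (tA j b \<otimes> tA i a) =
      (koszul (ipar a * ipar b) * qq powi phi b a) *\<^sub>q (tA i a \<otimes> tA j b)
      + (of_bool (b < a) * xi) *\<^sub>q (tA i b \<otimes> tA j a)
      + (of_bool (- b < a) * koszul (ipar a) * xi) *\<^sub>q (tA i (- b) \<otimes> tA j (- a)))"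
  (is "\<exists>!\<Theta>. ?P \<Theta>")
proof (rule ex1I)
  \<comment> \<open>The left algebra plays the part of the supermodule; equivariance will involve
    both given actions.\<close>
  let ?\<Theta> = "braid \<Phi>\<^sub>k :: ('k, 'n) Aq \<otimes> ('r, 'n) Aq \<Rightarrow> ('r, 'n) Aq \<otimes> ('k, 'n) Aq"
  note sup = coord_actionD[OF assms(1)]
  note lin = braid_linear[OF sup(2)]
  have gen: "?\<Theta> (tA j b \<otimes> tA i a) =
      (koszul (ipar a * ipar b) * qq powi phi b a) *\<^sub>q (tA i a \<otimes> tA j b)
      + (of_bool (b < a) * xi) *\<^sub>q (tA i b \<otimes> tA j a)
      + (of_bool (- b < a) * koszul (ipar a) * xi) *\<^sub>q (tA i (- b) \<otimes> tA j (- a))" for i j a b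
    unfolding braid_tA_tA[OF assms(1)] Shat_sum by (simp only: mult.commute[of "ipar a"])
  \<comment> \<open>Both composites are linear, so they are compared on pure tensors, splitting
    first the outer and then the inner tensor product.\<close>
  have right: "(?\<Theta> \<circ> tmap id mul) z
      = (tmap mul id \<circ> tassoc' \<circ> tmap id ?\<Theta> \<circ> tassoc \<circ> tmap ?\<Theta> id \<circ> tassoc') z" for z
  proof -
    have l: "qlinear (\<lambda>z. ?\<Theta> (tmap id mul z))"
      by (rule qlinear_compose[OF tmap_linear[OF qlinear_id mul_linear] lin])
    have r: "qlinear (\<lambda>z. tmap mul id (tassoc' (tmap id ?\<Theta> (tassoc (tmap ?\<Theta> id (tassoc' z))))))"
      by (rule qlinear_compose[OF qlinear_compose[OF qlinear_compose[OF qlinear_compose[OF qlinear_compose[OF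
          tassoc'_linear tmap_linear[OF lin qlinear_id]] tassoc_linear] tmap_linear[OF qlinear_id lin]]
          tassoc'_linear] tmap_linear[OF mul_linear qlinear_id]])
    have t: "?\<Theta> (tmap id mul (y \<otimes> w)) = tmap mul id (tassoc' (tmap id ?\<Theta> (tassoc (tmap ?\<Theta> id (tassoc' (y \<otimes> w))))))" for y and w :: "('r, 'n) Aq \<otimes> ('r, 'n) Aq"
      by (rule qlinear_tensor_eqI[OF qlinear_compose[OF qlinear_tens(2) l] qlinear_compose[OF qlinear_tens(2) r]])
        (simp only: tmap_id_left_tens[OF mul_linear] mul_tens tassoc'_tens tmap_id_right_tens[OF lin]
          braid_mult_right[OF sup(2)])
    show ?thesis unfolding o_apply by (rule qlinear_tensor_eqI[OF l r t])
  qed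
  have left: "(?\<Theta> \<circ> tmap mul id) z
      = (tmap id mul \<circ> tassoc \<circ> tmap ?\<Theta> id \<circ> tassoc' \<circ> tmap id ?\<Theta> \<circ> tassoc) z" for z
  proof -
    have l: "qlinear (\<lambda>z. ?\<Theta> (tmap mul id z))"
      by (rule qlinear_compose[OF tmap_linear[OF mul_linear qlinear_id] lin])
    have r: "qlinear (\<lambda>z. tmap id mul (tassoc (tmap ?\<Theta> id (tassoc' (tmap id ?\<Theta> (tassoc z))))))"
      by (rule qlinear_compose[OF qlinear_compose[OF qlinear_compose[OF qlinear_compose[OF qlinear_compose[OF
          tassoc_linear tmap_linear[OF qlinear_id lin]] tassoc'_linear] tmap_linear[OF lin qlinear_id]]
          tassoc_linear] tmap_linear[OF qlinear_id mul_linear]])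
    have t: "?\<Theta> (tmap mul id (w \<otimes> x)) = tmap id mul (tassoc (tmap ?\<Theta> id (tassoc' (tmap id ?\<Theta> (tassoc (w \<otimes> x))))))" for x and w :: "('k, 'n) Aq \<otimes> ('k, 'n) Aq"
      by (rule qlinear_tensor_eqI[OF qlinear_compose[OF qlinear_tens(1) l] qlinear_compose[OF qlinear_tens(1) r]])
        (simp only: tmap_id_right_tens[OF mul_linear] mul_tens tassoc_tens tmap_id_left_tens[OF lin]
          braid_mult_left[OF sup(1)])
    show ?thesis unfolding o_apply by (rule qlinear_tensor_eqI[OF l r t])
  qed
  show "?P ?\<Theta>"
    by (intro conjI allI gen ext right left braid_1_left[OF sup(1)] braid_1[OF sup(2)]
        braid_supermodule_hom[OF sup(2) assms(2)])
  fix \<Theta>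
  assume P: "?P \<Theta>"
  then have lin': "qlinear \<Theta>" by (simp only: supermodule_hom_def)
  have r: "\<Theta> \<circ> tmap id mul = tmap mul id \<circ> tassoc' \<circ> tmap id \<Theta> \<circ> tassoc \<circ> tmap \<Theta> id \<circ> tassoc'"
    and l: "\<Theta> \<circ> tmap mul id = tmap id mul \<circ> tassoc \<circ> tmap \<Theta> id \<circ> tassoc' \<circ> tmap id \<Theta> \<circ> tassoc"
    using P by blast+
  \<comment> \<open>Evaluating the composite identities on pure tensors gives the elementwise rules
    that \<open>braid_unique\<close> asks for.\<close>
  show "\<Theta> = ?\<Theta>"
  proof (rule braid_unique[OF assms(1) lin'])
    show "\<Theta> (y \<otimes> (x * x')) = tmap mul id (tassoc' (tmap id \<Theta> (tassoc (\<Theta> (y \<otimes> x) \<otimes> x'))))" for y x x'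
      using fun_cong[OF r, of "y \<otimes> (x \<otimes> x')"]
      by (simp only: o_apply tmap_id_left_tens[OF mul_linear] mul_tens tassoc'_tens tmap_id_right_tens[OF lin'])
    show "\<Theta> ((y * y') \<otimes> x) = tmap id mul (tassoc (tmap \<Theta> id (tassoc' (y \<otimes> \<Theta> (y' \<otimes> x)))))" for y y' x
      using fun_cong[OF l, of "(y \<otimes> y') \<otimes> x"]
      by (simp only: o_apply tmap_id_right_tens[OF mul_linear] mul_tens tassoc_tens tmap_id_left_tens[OF lin'])
    show "\<Theta> (1 \<otimes> x) = x \<otimes> 1" "\<Theta> (y \<otimes> 1) = 1 \<otimes> y" for x y using P by blast+
    show "\<Theta> (tA j b \<otimes> tA i a) = ?\<Theta> (tA j b \<otimes> tA i a)" for i j a b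
      using P unfolding gen by blast
  qed
qed

end
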